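(* Let $n,d\in\mathbb{N}$, $\alpha\in(0,1]$, $\tilde\alpha\ge0$, let $J$ be a real symmetric $n\times n$ matrix with $J_{ii}=0$ and $\max_i\sum_j|J_{ij}|\le1-\alpha$, let $h\in\mathbb{R}^n$ with $\|h\|_\infty\le\tilde\alpha$, and let $q^n$ be the probability measure on $\{-1,+1\}^n$ proportional to $\exp\big(\tfrac12\sum_{i,j}J_{ij}\sigma_i\sigma_j+\sum_i h_i\sigma_i\big)$. Let $f:\{-1,+1\}^n\to\mathbb{R}$ satisfy \[ \|\mathfrak{h}^{(k)}f\|_2\le 1\quad\text{for all }k=1,\ldots,d-1,\qquad \|\mathfrak{h}^{(d)}f\|_\infty\le1 . \] Then there exists a constant $C=C(\alpha,\tilde\alpha,d)>0$ (not depending on $n$ or $f$) such that \[ \mathbb{E}_{q^n}\exp\big(C|f-\mathbb{E}_{q^n}f|^{2/d}\big)\le 2, \] and in particular $q^n(|f-\mathbb{E}_{q^n}f|\ge t)\le 2\exp(-Ct^{2/d})$ for all $t>0$.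
   Context: For $\sigma\in\{-1,+1\}^n$, $T_i\sigma$ is $\sigma$ with the $i$-th coordinate flipped. For $g:\{-1,+1\}^n\to\mathbb{R}$ set $\mathfrak{h}_ig(\sigma)=\frac{1}{\sqrt2}|g(\sigma)-g(T_i\sigma)|$, and iteratively $\mathfrak{h}_{i_1\ldots i_d}g=\mathfrak{h}_{i_1}(\mathfrak{h}_{i_2\ldots i_d}g)$. $\mathfrak{h}^{(d)}f(\sigma)$ is the tensor $(\mathfrak{h}_{i_1\ldots i_d}f(\sigma))_{i_1,\ldots,i_d\in\{1,\ldots,n\}}$ and $|\mathfrak{h}^{(d)}f|(\sigma)$ its Euclidean norm. $\|\mathfrak{h}^{(d)}f\|_p=(\mathbb{E}_{q^n}|\mathfrak{h}^{(d)}f|^p)^{1/p}$ and $\|\cdot\|_\infty$ is the maximum over the support of $q^n$. *)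

theory Defs
  imports Complex_Main
begin

definition cube :: "nat \<Rightarrow> (nat \<Rightarrow> real) set" where
  "cube n = {\<sigma>. (\<forall>i<n. \<sigma> i = -1 \<or> \<sigma> i = 1) \<and> (\<forall>i\<ge>n. \<sigma> i = 0)}"

definition flip :: "nat \<Rightarrow> (nat \<Rightarrow> real) \<Rightarrow> (nat \<Rightarrow> real)" where
  "flip i \<sigma> = \<sigma>(i := - \<sigma> i)"

definition hdiff :: "nat \<Rightarrow> ((nat \<Rightarrow> real) \<Rightarrow> real) \<Rightarrow> (nat \<Rightarrow> real) \<Rightarrow> real" where
  "hdiff i g \<sigma> = \<bar>g \<sigma> - g (flip i \<sigma>)\<bar> / sqrt 2"

fun hiter :: "nat list \<Rightarrow> ((nat \<Rightarrow> real) \<Rightarrow> real) \<Rightarrow> (nat \<Rightarrow> real) \<Rightarrow> real" where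
  "hiter [] g = g"
| "hiter (i # is) g = hdiff i (hiter is g)"

definition htensor_norm :: "nat \<Rightarrow> nat \<Rightarrow> ((nat \<Rightarrow> real) \<Rightarrow> real) \<Rightarrow> (nat \<Rightarrow> real) \<Rightarrow> real" where
  "htensor_norm n d f \<sigma> =
     sqrt (\<Sum>is\<in>{is. length is = d \<and> set is \<subseteq> {..<n}}. (hiter is f \<sigma>)\<^sup>2)"

definition gibbs_weight :: "nat \<Rightarrow> (nat \<Rightarrow> nat \<Rightarrow> real) \<Rightarrow> (nat \<Rightarrow> real) \<Rightarrow> (nat \<Rightarrow> real) \<Rightarrow> real" where
  "gibbs_weight n J h \<sigma> =
     exp ((1/2) * (\<Sum>i<n. \<Sum>j<n. J i j * \<sigma> i * \<sigma> j) + (\<Sum>i<n. h i * \<sigma> i))"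

definition qprob :: "nat \<Rightarrow> (nat \<Rightarrow> nat \<Rightarrow> real) \<Rightarrow> (nat \<Rightarrow> real) \<Rightarrow> (nat \<Rightarrow> real) \<Rightarrow> real" where
  "qprob n J h \<sigma> = gibbs_weight n J h \<sigma> / (\<Sum>\<tau>\<in>cube n. gibbs_weight n J h \<tau>)"

definition qexp :: "nat \<Rightarrow> (nat \<Rightarrow> nat \<Rightarrow> real) \<Rightarrow> (nat \<Rightarrow> real) \<Rightarrow> ((nat \<Rightarrow> real) \<Rightarrow> real) \<Rightarrow> real" where
  "qexp n J h g = (\<Sum>\<sigma>\<in>cube n. qprob n J h \<sigma> * g \<sigma>)"

definition qmeasure :: "nat \<Rightarrow> (nat \<Rightarrow> nat \<Rightarrow> real) \<Rightarrow> (nat \<Rightarrow> real) \<Rightarrow> ((nat \<Rightarrow> real) \<Rightarrow> bool) \<Rightarrow> real" where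
  "qmeasure n J h P = (\<Sum>\<sigma>\<in>{\<sigma>\<in>cube n. P \<sigma>}. qprob n J h \<sigma>)"

definition hnorm2 :: "nat \<Rightarrow> (nat \<Rightarrow> nat \<Rightarrow> real) \<Rightarrow> (nat \<Rightarrow> real) \<Rightarrow> nat \<Rightarrow> ((nat \<Rightarrow> real) \<Rightarrow> real) \<Rightarrow> real" where
  "hnorm2 n J h d f = sqrt (qexp n J h (\<lambda>\<sigma>. (htensor_norm n d f \<sigma>)\<^sup>2))"

definition hnorm_inf :: "nat \<Rightarrow> (nat \<Rightarrow> nat \<Rightarrow> real) \<Rightarrow> (nat \<Rightarrow> real) \<Rightarrow> nat \<Rightarrow> ((nat \<Rightarrow> real) \<Rightarrow> real) \<Rightarrow> real" where
  "hnorm_inf n J h d f = Max ((htensor_norm n d f) ` {\<sigma>\<in>cube n. qprob n J h \<sigma> > 0})"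

end

theory Submission
  imports Defs "HOL-Analysis.L2_Norm"
begin

text \<open>
  The Ising measure has weak dependence in the sense of Dobrushin: the conditional probability of one
  spin depends on the other spins with a matrix of influences of row sums at most \<open>1 - \<alpha>\<close>. Dobrushin's
  comparison argument (replace a test function by its heat-bath average at one site, and iterate)
  bounds the \<open>\<ell>\<^sup>2\<close> distance of the vectors of one-spin marginals of two measures by the Dirichlet
  form of the square root of the relative density. Following Marton, this controls the marginal
  terms in the chain rule for the entropy; averaging the chain rule over the spin that is frozen, an
  induction on the number of spins gives a logarithmic Sobolev inequality with a constant that does
  not depend on that number.

  Applied to powers of \<open>g\<close>, the inequality yields
  \<open>\<parallel>g\<parallel>\<^sub>p \<le> \<parallel>g\<parallel>\<^sub>1 + (K p)\<^bsup>1/2\<^esup> \<parallel>grad g\<parallel>\<^sub>p\<close> for \<open>p\<close> a power of two. The gradient of the norm of the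
  difference tensor of order \<open>k\<close> is at most the norm of the tensor of order \<open>k + 1\<close>, so iterating
  \<open>d\<close> times gives \<open>\<parallel>f - E f\<parallel>\<^sub>p = O(p\<^bsup>d/2\<^esup>)\<close>, and summing the exponential series gives the claim.
\<close>

section \<open>Spin configurations and Dobrushin's comparison theorem\<close>

text \<open>The site set is arbitrary because the induction on the number of spins removes arbitrary
  sites. Coordinates off \<open>V\<close> are pinned to 0, so that a configuration is determined by
  its spins and equality of functions is equality of configurations.\<close>

definition spins :: "nat set \<Rightarrow> (nat \<Rightarrow> real) set" where
  "spins V = {\<sigma>. (\<forall>i\<in>V. \<sigma> i = -1 \<or> \<sigma> i = 1) \<and> (\<forall>i. i \<notin> V \<longrightarrow> \<sigma> i = 0)}"

lemma cube_eq_spins: "cube n = spins {..<n}"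
  by (auto simp: cube_def spins_def)

lemma flip_flip [simp]: "flip i (flip i \<sigma>) = \<sigma>"
  by (auto simp: flip_def fun_eq_iff)

lemma flip_commute: "flip i (flip j \<sigma>) = flip j (flip i \<sigma>)"
  by (auto simp: flip_def fun_eq_iff)

lemma flip_in_spins [simp]: "flip i \<sigma> \<in> spins V \<longleftrightarrow> \<sigma> \<in> spins V"
proof -
  have "flip i \<tau> \<in> spins V" if "\<tau> \<in> spins V" for \<tau>
    using that unfolding spins_def flip_def by (simp, metis minus_minus)
  from this[of \<sigma>] this[of "flip i \<sigma>"] show ?thesis by auto
qed

lemma flip_fun_upd: "i \<noteq> j \<Longrightarrow> flip j (\<sigma>(i := s)) = (flip j \<sigma>)(i := s)"
  by (auto simp: flip_def fun_eq_iff)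

lemma fun_upd_in_spins:
  "i \<in> V \<Longrightarrow> s \<in> {-1, 1} \<Longrightarrow> \<sigma> \<in> spins (V - {i}) \<Longrightarrow> \<sigma>(i := s) \<in> spins V"
  by (auto simp: spins_def)

lemma sum_flip: "(\<Sum>\<sigma>\<in>spins V. F (flip i \<sigma>)) = (\<Sum>\<sigma>\<in>spins V. F \<sigma>)"
  by (rule sum.reindex_bij_witness[of _ "flip i" "flip i"]) auto

lemma spins_split:
  assumes "i \<in> V"
  shows "bij_betw (\<lambda>(s, \<sigma>). \<sigma>(i := s)) ({-1, 1} \<times> spins (V - {i})) (spins V)"
proof (rule bij_betw_byWitness[where f' = "\<lambda>\<sigma>. (\<sigma> i, \<sigma>(i := 0))"])
  show "\<forall>a\<in>{-1, 1} \<times> spins (V - {i}).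
      (\<lambda>\<sigma>. (\<sigma> i, \<sigma>(i := 0))) (case a of (s, \<sigma>) \<Rightarrow> \<sigma>(i := s)) = a"
    using assms by (force simp: spins_def fun_eq_iff)
  show "\<forall>a'\<in>spins V. (case (a' i, a'(i := 0)) of (s, \<sigma>) \<Rightarrow> \<sigma>(i := s)) = a'"
    by auto
  show "(\<lambda>(s, \<sigma>). \<sigma>(i := s)) ` ({-1, 1} \<times> spins (V - {i})) \<subseteq> spins V"
    using fun_upd_in_spins[OF assms] by auto
  show "(\<lambda>\<sigma>. (\<sigma> i, \<sigma>(i := 0))) ` spins V \<subseteq> {-1, 1} \<times> spins (V - {i})"
    using assms by (auto simp: spins_def)
qed

lemma sum_spins_split:
  assumes "i \<in> V"
  shows "(\<Sum>\<sigma>\<in>spins V. F \<sigma>) = (\<Sum>s\<in>{-1, 1}. \<Sum>\<sigma>\<in>spins (V - {i}). F (\<sigma>(i := s)))"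
proof -
  have "(\<Sum>\<sigma>\<in>spins V. F \<sigma>) = (\<Sum>a\<in>{-1, 1} \<times> spins (V - {i}). F ((\<lambda>(s, \<sigma>). \<sigma>(i := s)) a))"
    by (rule sum.reindex_bij_betw[OF spins_split[OF assms], symmetric])
  also have "\<dots> = (\<Sum>(s, \<sigma>)\<in>{-1, 1} \<times> spins (V - {i}). F (\<sigma>(i := s)))"
    by (rule sum.cong) auto
  finally show ?thesis by (simp only: sum.cartesian_product)
qed

lemma spins_empty: "spins {} = {\<lambda>_. 0}"
  by (auto simp: spins_def)

lemma finite_spins:
  assumes "finite V" shows "finite (spins V)"
  using assms
proof (induction V)
  case empty
  then show ?case by (simp add: spins_empty)
next
  case (insert i V)
  have "bij_betw (\<lambda>(s, \<sigma>). \<sigma>(i := s)) ({-1, 1} \<times> spins V) (spins (insert i V))"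
    using spins_split[of i "insert i V"] insert.hyps by simp
  then show ?case using insert.IH
    by (metis bij_betw_finite finite.emptyI finite.insertI finite_cartesian_product)
qed

lemma spins_nonempty: "spins V \<noteq> {}"
proof -
  have "(\<lambda>i. if i \<in> V then 1 else 0) \<in> spins V" by (auto simp: spins_def)
  then show ?thesis by blast
qed

text \<open>Walk from \<open>\<sigma>\<close> to \<open>\<tau>\<close> one site at a time; each move
  is trivial or a single flip, so the one-site oscillations add up.\<close>

lemma spins_dist:
  fixes g :: "(nat \<Rightarrow> real) \<Rightarrow> real" and \<delta> :: "nat \<Rightarrow> real"
  assumes "finite V" "\<sigma> \<in> spins V" "\<tau> \<in> spins V"
    and lip: "\<And>j \<eta>. j \<in> V \<Longrightarrow> \<eta> \<in> spins V \<Longrightarrow> \<bar>g \<eta> - g (flip j \<eta>)\<bar> \<le> \<delta> j"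
  shows "\<bar>g \<sigma> - g \<tau>\<bar> \<le> sum \<delta> V"
proof -
  \<comment> \<open>The intermediate points of the walk agree with \<open>\<tau>\<close> on
    \<open>W\<close> and with \<open>\<sigma>\<close> elsewhere.\<close>
  have step: "\<bar>g \<sigma> - g (\<lambda>i. if i \<in> W then \<tau> i else \<sigma> i)\<bar> \<le> sum \<delta> W" if "W \<subseteq> V" for W
    using finite_subset[OF that assms(1)] that
  proof (induction W)
    case empty
    have "(\<lambda>i. if i \<in> {} then \<tau> i else \<sigma> i) = \<sigma>" by simp
    then show ?case by (simp only:) simp
  next
    case (insert i W)
    let ?\<eta> = "\<lambda>j. if j \<in> W then \<tau> j else \<sigma> j"
    let ?\<eta>' = "\<lambda>j. if j \<in> insert i W then \<tau> j else \<sigma> j"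
    have \<eta>: "?\<eta> \<in> spins V" using assms(2,3) by (auto simp: spins_def)
    have "\<tau> i = \<sigma> i \<or> \<tau> i = - \<sigma> i"
      using assms(2,3) insert.prems by (force simp: spins_def)
    then have "?\<eta>' = ?\<eta> \<or> ?\<eta>' = flip i ?\<eta>"
      using insert.hyps by (auto simp: flip_def fun_eq_iff)
    moreover have "\<bar>g ?\<eta> - g (flip i ?\<eta>)\<bar> \<le> \<delta> i"
      using lip[OF _ \<eta>] insert.prems by blast
    ultimately have "\<bar>g ?\<eta> - g ?\<eta>'\<bar> \<le> \<delta> i" by auto
    moreover have "\<bar>g \<sigma> - g ?\<eta>\<bar> \<le> sum \<delta> W" using insert by blast
    ultimately show ?case using insert.hyps by (simp only: sum.insert[OF insert.hyps])
  qed
  have "(\<lambda>i. if i \<in> V then \<tau> i else \<sigma> i) = \<tau>" using assms(2,3) by (auto simp: spins_def fun_eq_iff)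
  with step[of V] show ?thesis by simp
qed

text \<open>The quotient \<open>w \<sigma> / (w \<sigma> + w (flip j \<sigma>))\<close> is the conditional probability of \<open>\<sigma> j\<close> given the
  other spins, so \<open>A i j\<close> bounds the influence of spin \<open>i\<close> on spin \<open>j\<close>. No normalisation of \<open>w\<close> is
  assumed, which makes the class closed under freezing a spin.\<close>

locale weak_dep =
  fixes V :: "nat set" and A :: "nat \<Rightarrow> nat \<Rightarrow> real" and R \<alpha> :: real
    and w :: "(nat \<Rightarrow> real) \<Rightarrow> real"
  assumes fin: "finite V"
    and \<alpha>: "0 < \<alpha>" "\<alpha> \<le> 1"
    and w_pos: "\<sigma> \<in> spins V \<Longrightarrow> 0 < w \<sigma>"
    and ratio: "i \<in> V \<Longrightarrow> \<sigma> \<in> spins V \<Longrightarrow> w (flip i \<sigma>) \<le> R * w \<sigma>"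
    and A_nonneg: "i \<in> V \<Longrightarrow> j \<in> V \<Longrightarrow> 0 \<le> A i j"
    and A_sym: "i \<in> V \<Longrightarrow> j \<in> V \<Longrightarrow> A i j = A j i"
    and A_row: "i \<in> V \<Longrightarrow> (\<Sum>j\<in>V. A i j) \<le> 1 - \<alpha>"
    and influence: "i \<in> V \<Longrightarrow> j \<in> V \<Longrightarrow> i \<noteq> j \<Longrightarrow> \<sigma> \<in> spins V \<Longrightarrow>
      \<bar>w \<sigma> / (w \<sigma> + w (flip j \<sigma>))
       - w (flip i \<sigma>) / (w (flip i \<sigma>) + w (flip j (flip i \<sigma>)))\<bar> \<le> A i j"

text \<open>The conditional law of a remaining spin given all others is untouched by freezing spin
  \<open>i\<close>. The influences and the ratio bound are therefore inherited with the same
  constants, and a row of \<open>A\<close> only loses a nonnegative entry. This is what lets the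
  induction for the logarithmic Sobolev inequality keep its constant.\<close>

lemma (in weak_dep) freeze:
  assumes "i \<in> V" "s \<in> {-1, 1}"
  shows "weak_dep (V - {i}) A R \<alpha> (\<lambda>\<sigma>. w (\<sigma>(i := s)))"
proof
  fix j assume j: "j \<in> V - {i}"
  have "(\<Sum>k\<in>V - {i}. A j k) \<le> (\<Sum>k\<in>V. A j k)"
    using j fin A_nonneg by (intro sum_mono2) auto
  also have "\<dots> \<le> 1 - \<alpha>" using A_row j by blast
  finally show "(\<Sum>k\<in>V - {i}. A j k) \<le> 1 - \<alpha>" .
next
  fix j \<sigma> assume j: "j \<in> V - {i}" and \<sigma>: "\<sigma> \<in> spins (V - {i})"
  show "w ((flip j \<sigma>)(i := s)) \<le> R * w (\<sigma>(i := s))"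
    using ratio[OF _ fun_upd_in_spins[OF assms \<sigma>], of j] j by (simp add: flip_fun_upd)
next
  fix j k \<sigma> assume j: "j \<in> V - {i}" "k \<in> V - {i}" "j \<noteq> k" and \<sigma>: "\<sigma> \<in> spins (V - {i})"
  show "\<bar>w (\<sigma>(i := s)) / (w (\<sigma>(i := s)) + w ((flip k \<sigma>)(i := s)))
       - w ((flip j \<sigma>)(i := s)) / (w ((flip j \<sigma>)(i := s)) + w ((flip k (flip j \<sigma>))(i := s)))\<bar> \<le> A j k"
    using influence[of j k, OF _ _ _ fun_upd_in_spins[OF assms \<sigma>]] j by (simp add: flip_fun_upd)
qed (use fin \<alpha> A_nonneg A_sym w_pos fun_upd_in_spins[OF assms] in auto)

section \<open>Heat-bath averages and the comparison of one-spin marginals\<close>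

context weak_dep
begin

text \<open>This is the conditional expectation of \<open>g\<close> given all spins except the one
  at \<open>j\<close>.\<close>

definition heat :: "nat \<Rightarrow> ((nat \<Rightarrow> real) \<Rightarrow> real) \<Rightarrow> (nat \<Rightarrow> real) \<Rightarrow> real" where
  "heat j g \<sigma> = (w \<sigma> * g \<sigma> + w (flip j \<sigma>) * g (flip j \<sigma>)) / (w \<sigma> + w (flip j \<sigma>))"

lemma heat_flip: "heat j g (flip j \<sigma>) = heat j g \<sigma>"
  by (simp add: heat_def add.commute)

text \<open>A flip at \<open>i\<close> acts in two ways: it changes the values of \<open>g\<close>
  that are averaged, by at most \<open>\<delta> i\<close>, and it changes the law of spin
  \<open>j\<close>, by at most \<open>A i j\<close>. The second change is multiplied by an
  oscillation of \<open>g\<close> at \<open>j\<close>.\<close>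

lemma heat_lipschitz:
  assumes "i \<in> V" "j \<in> V" "i \<noteq> j" "\<sigma> \<in> spins V"
    and lip: "\<And>j \<sigma>. j \<in> V \<Longrightarrow> \<sigma> \<in> spins V \<Longrightarrow> \<bar>g \<sigma> - g (flip j \<sigma>)\<bar> \<le> \<delta> j"
  shows "\<bar>heat j g \<sigma> - heat j g (flip i \<sigma>)\<bar> \<le> \<delta> i + A i j * \<delta> j"
proof -
  define p where "p \<tau> = w \<tau> / (w \<tau> + w (flip j \<tau>))" for \<tau>
  have pos: "0 < w \<tau>" "0 < w (flip j \<tau>)" if "\<tau> \<in> spins V" for \<tau>
    using that w_pos by auto
  have heat: "heat j g \<tau> = p \<tau> * g \<tau> + (1 - p \<tau>) * g (flip j \<tau>)" if "\<tau> \<in> spins V" for \<tau>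
  proof -
    have "1 - p \<tau> = w (flip j \<tau>) / (w \<tau> + w (flip j \<tau>))"
      using pos[OF that] by (simp add: p_def field_simps)
    then show ?thesis by (simp add: heat_def p_def add_divide_distrib)
  qed
  have p: "0 \<le> p \<sigma>" "p \<sigma> \<le> 1" using pos[OF assms(4)] by (auto simp: p_def)
  let ?a = "g \<sigma> - g (flip i \<sigma>)" and ?b = "g (flip j \<sigma>) - g (flip i (flip j \<sigma>))"
    and ?c = "g (flip i \<sigma>) - g (flip j (flip i \<sigma>))"
  have "heat j g \<sigma> - heat j g (flip i \<sigma>)
      = p \<sigma> * ?a + (1 - p \<sigma>) * ?b + (p \<sigma> - p (flip i \<sigma>)) * ?c"
    using assms(4) by (simp add: heat flip_commute[of j i] algebra_simps)
  also have "\<bar>\<dots>\<bar> \<le> p \<sigma> * \<delta> i + (1 - p \<sigma>) * \<delta> i + A i j * \<delta> j"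
  proof (intro order_trans[OF abs_triangle_ineq] add_mono)
    show "\<bar>p \<sigma> * ?a\<bar> \<le> p \<sigma> * \<delta> i" "\<bar>(1 - p \<sigma>) * ?b\<bar> \<le> (1 - p \<sigma>) * \<delta> i"
      using lip assms p by (auto simp: abs_mult intro!: mult_left_mono)
    have "\<bar>p \<sigma> - p (flip i \<sigma>)\<bar> \<le> A i j"
      using influence[OF assms(1-4)] by (simp add: p_def)
    then show "\<bar>(p \<sigma> - p (flip i \<sigma>)) * ?c\<bar> \<le> A i j * \<delta> j"
      using lip[of j "flip i \<sigma>"] assms by (auto simp: abs_mult intro!: mult_mono A_nonneg)
  qed
  finally show ?thesis by (simp add: algebra_simps)
qed

text \<open>Symmetrise over the pair \<open>\<sigma>\<close>, \<open>flip j \<sigma>\<close>: the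
  heat-bath average is the same at both, so only the difference of \<open>\<rho>\<close> across the
  flip survives. Each pair is counted twice, hence the division by 2.\<close>

lemma sum_heat:
  assumes "j \<in> V"
  shows "(\<Sum>\<sigma>\<in>spins V. w \<sigma> * \<rho> \<sigma> * (g \<sigma> - heat j g \<sigma>))
    = (\<Sum>\<sigma>\<in>spins V. w \<sigma> * (w (flip j \<sigma>) / (w \<sigma> + w (flip j \<sigma>)))
        * ((g \<sigma> - g (flip j \<sigma>)) * (\<rho> \<sigma> - \<rho> (flip j \<sigma>)))) / 2" (is "?L = ?S / 2")
proof -
  let ?F = "\<lambda>\<sigma>. w \<sigma> * \<rho> \<sigma> * (g \<sigma> - heat j g \<sigma>)"
  have "2 * ?L = (\<Sum>\<sigma>\<in>spins V. ?F \<sigma>) + (\<Sum>\<sigma>\<in>spins V. ?F (flip j \<sigma>))"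
    unfolding sum_flip[of ?F] by simp
  also have "\<dots> = (\<Sum>\<sigma>\<in>spins V. ?F \<sigma> + ?F (flip j \<sigma>))"
    by (simp add: sum.distrib)
  also have "\<dots> = ?S"
  proof (rule sum.cong[OF refl])
    fix \<sigma> assume \<sigma>: "\<sigma> \<in> spins V"
    have "0 < w \<sigma> + w (flip j \<sigma>)" using w_pos \<sigma> by (simp add: add_pos_pos)
    then show "?F \<sigma> + ?F (flip j \<sigma>) = w \<sigma> * (w (flip j \<sigma>) / (w \<sigma> + w (flip j \<sigma>)))
        * ((g \<sigma> - g (flip j \<sigma>)) * (\<rho> \<sigma> - \<rho> (flip j \<sigma>)))"
      unfolding heat_flip by (simp add: heat_def divide_simps) (simp add: algebra_simps)
  qed
  finally show ?thesis by simp
qed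

definition Z where "Z = (\<Sum>\<sigma>\<in>spins V. w \<sigma>)"

lemma Z_pos: "0 < Z"
  unfolding Z_def by (intro sum_pos finite_spins fin spins_nonempty w_pos)

text \<open>The measure is invariant under the heat bath: for constant \<open>\<rho>\<close> the
  difference in \<open>sum_heat\<close> vanishes.\<close>

lemma sum_heat_1: "j \<in> V \<Longrightarrow> (\<Sum>\<sigma>\<in>spins V. w \<sigma> * heat j g \<sigma>) = (\<Sum>\<sigma>\<in>spins V. w \<sigma> * g \<sigma>)"
  using sum_heat[of j "\<lambda>_. 1" g] by (simp add: right_diff_distrib sum_subtractf)

text \<open>In the language of Dobrushin's comparison theorem, \<open>x\<close> is an estimate for
  the pair of measures with weights \<open>w * \<rho>\<close> and \<open>w\<close>, both normalised:
  an oscillation of the test function at site \<open>j\<close> costs at most the factor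
  \<open>x j\<close>.\<close>

definition dominates :: "((nat \<Rightarrow> real) \<Rightarrow> real) \<Rightarrow> (nat \<Rightarrow> real) \<Rightarrow> bool" where
  "dominates \<rho> x \<longleftrightarrow> (\<forall>i\<in>V. 0 \<le> x i) \<and> (\<forall>g \<delta>.
     (\<forall>j\<in>V. \<forall>\<sigma>\<in>spins V. \<bar>g \<sigma> - g (flip j \<sigma>)\<bar> \<le> \<delta> j) \<longrightarrow>
     \<bar>(\<Sum>\<sigma>\<in>spins V. w \<sigma> * \<rho> \<sigma> * g \<sigma>) / (\<Sum>\<sigma>\<in>spins V. w \<sigma> * \<rho> \<sigma>)
       - (\<Sum>\<sigma>\<in>spins V. w \<sigma> * g \<sigma>) / Z\<bar> \<le> (\<Sum>j\<in>V. \<delta> j * x j))"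

text \<open>The \<open>L1\<close> norm, up to the factor \<open>Z\<close>, of the discrete
  derivative at \<open>j\<close> of the normalised density. It controls the error made when
  \<open>g\<close> is replaced by its heat-bath average under the measure with density
  \<open>\<rho>\<close>.\<close>

definition defect :: "((nat \<Rightarrow> real) \<Rightarrow> real) \<Rightarrow> nat \<Rightarrow> real" where
  "defect \<rho> j = (\<Sum>\<sigma>\<in>spins V. w \<sigma> * \<bar>\<rho> \<sigma> - \<rho> (flip j \<sigma>)\<bar>) / (\<Sum>\<sigma>\<in>spins V. w \<sigma> * \<rho> \<sigma>)"

lemma dominatesD:
  assumes "dominates \<rho> x"
    and "\<And>j \<sigma>. j \<in> V \<Longrightarrow> \<sigma> \<in> spins V \<Longrightarrow> \<bar>g \<sigma> - g (flip j \<sigma>)\<bar> \<le> \<delta> j"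
  shows "\<bar>(\<Sum>\<sigma>\<in>spins V. w \<sigma> * \<rho> \<sigma> * g \<sigma>) / (\<Sum>\<sigma>\<in>spins V. w \<sigma> * \<rho> \<sigma>)
       - (\<Sum>\<sigma>\<in>spins V. w \<sigma> * g \<sigma>) / Z\<bar> \<le> (\<Sum>j\<in>V. \<delta> j * x j)"
  using assms unfolding dominates_def by blast

text \<open>A crude starting point for the iteration: each of the two means lies within
  \<open>sum \<delta> V\<close> of the value of \<open>g\<close> at one fixed configuration.\<close>

lemma dominates_one:
  assumes \<rho>: "\<And>\<sigma>. \<sigma> \<in> spins V \<Longrightarrow> 0 \<le> \<rho> \<sigma>" and F: "0 < (\<Sum>\<sigma>\<in>spins V. w \<sigma> * \<rho> \<sigma>)"
  shows "dominates \<rho> (\<lambda>_. 2)"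
  unfolding dominates_def
proof (intro conjI ballI allI impI)
  fix g :: "(nat \<Rightarrow> real) \<Rightarrow> real" and \<delta> :: "nat \<Rightarrow> real"
  assume *: "\<forall>j\<in>V. \<forall>\<sigma>\<in>spins V. \<bar>g \<sigma> - g (flip j \<sigma>)\<bar> \<le> \<delta> j"
  obtain \<tau> where \<tau>: "\<tau> \<in> spins V" using spins_nonempty by blast
  have mean: "\<bar>(\<Sum>\<sigma>\<in>spins V. w \<sigma> * \<theta> \<sigma> * g \<sigma>) / (\<Sum>\<sigma>\<in>spins V. w \<sigma> * \<theta> \<sigma>) - g \<tau>\<bar> \<le> sum \<delta> V"
    if \<theta>: "\<And>\<sigma>. \<sigma> \<in> spins V \<Longrightarrow> 0 \<le> \<theta> \<sigma>" and F: "0 < (\<Sum>\<sigma>\<in>spins V. w \<sigma> * \<theta> \<sigma>)" for \<theta>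
  proof -
    let ?F = "\<Sum>\<sigma>\<in>spins V. w \<sigma> * \<theta> \<sigma>"
    have "(\<Sum>\<sigma>\<in>spins V. w \<sigma> * \<theta> \<sigma> * g \<sigma>) - ?F * g \<tau> = (\<Sum>\<sigma>\<in>spins V. w \<sigma> * \<theta> \<sigma> * (g \<sigma> - g \<tau>))"
      by (simp add: right_diff_distrib sum_subtractf sum_distrib_right)
    also have "\<bar>\<dots>\<bar> \<le> (\<Sum>\<sigma>\<in>spins V. w \<sigma> * \<theta> \<sigma> * sum \<delta> V)"
    proof (rule order_trans[OF sum_abs sum_mono])
      fix \<sigma> assume \<sigma>: "\<sigma> \<in> spins V"
      have "\<bar>g \<sigma> - g \<tau>\<bar> \<le> sum \<delta> V" using spins_dist[OF fin \<sigma> \<tau>] * by blast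
      then show "\<bar>w \<sigma> * \<theta> \<sigma> * (g \<sigma> - g \<tau>)\<bar> \<le> w \<sigma> * \<theta> \<sigma> * sum \<delta> V"
        using w_pos[OF \<sigma>] \<theta>[OF \<sigma>] by (simp add: abs_mult mult_left_mono)
    qed
    also have "\<dots> = ?F * sum \<delta> V" by (rule sum_distrib_right[symmetric])
    also have "\<dots> = sum \<delta> V * ?F" by (rule mult.commute)
    finally have "\<bar>(\<Sum>\<sigma>\<in>spins V. w \<sigma> * \<theta> \<sigma> * g \<sigma>) - ?F * g \<tau>\<bar> / ?F \<le> sum \<delta> V"
      using F by (simp add: pos_divide_le_eq)
    moreover have "\<bar>(\<Sum>\<sigma>\<in>spins V. w \<sigma> * \<theta> \<sigma> * g \<sigma>) - ?F * g \<tau>\<bar> / ?F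
        = \<bar>(\<Sum>\<sigma>\<in>spins V. w \<sigma> * \<theta> \<sigma> * g \<sigma>) / ?F - g \<tau>\<bar>"
    proof -
      have "(\<Sum>\<sigma>\<in>spins V. w \<sigma> * \<theta> \<sigma> * g \<sigma>) / ?F - g \<tau>
          = ((\<Sum>\<sigma>\<in>spins V. w \<sigma> * \<theta> \<sigma> * g \<sigma>) - ?F * g \<tau>) / ?F"
        using F by (simp add: diff_divide_distrib)
      then show ?thesis by (simp only: abs_divide abs_of_pos[OF F])
    qed
    ultimately show ?thesis by simp
  qed
  show "\<bar>(\<Sum>\<sigma>\<in>spins V. w \<sigma> * \<rho> \<sigma> * g \<sigma>) / (\<Sum>\<sigma>\<in>spins V. w \<sigma> * \<rho> \<sigma>)
       - (\<Sum>\<sigma>\<in>spins V. w \<sigma> * g \<sigma>) / Z\<bar> \<le> (\<Sum>j\<in>V. \<delta> j * 2)"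
    using mean[of \<rho>, OF \<rho> F] mean[of "\<lambda>_. 1"] Z_pos
    by (simp add: Z_def sum_distrib_right[symmetric])
qed auto

text \<open>Compare the two means of \<open>heat j g\<close> instead of those of \<open>g\<close>.
  The mean under \<open>w\<close> does not change, the one under \<open>\<rho>\<close> changes by at
  most \<open>\<delta> j * defect \<rho> j\<close>, and the given estimate \<open>x\<close> applies
  to \<open>heat j g\<close>, which no longer oscillates at \<open>j\<close>.\<close>

lemma dominates_step:
  assumes \<rho>: "\<And>\<sigma>. \<sigma> \<in> spins V \<Longrightarrow> 0 \<le> \<rho> \<sigma>" and F: "0 < (\<Sum>\<sigma>\<in>spins V. w \<sigma> * \<rho> \<sigma>)"
    and x: "dominates \<rho> x" and j: "j \<in> V"
    and lip: "\<And>j \<sigma>. j \<in> V \<Longrightarrow> \<sigma> \<in> spins V \<Longrightarrow> \<bar>g \<sigma> - g (flip j \<sigma>)\<bar> \<le> \<delta> j"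
  shows "\<bar>(\<Sum>\<sigma>\<in>spins V. w \<sigma> * \<rho> \<sigma> * g \<sigma>) / (\<Sum>\<sigma>\<in>spins V. w \<sigma> * \<rho> \<sigma>)
       - (\<Sum>\<sigma>\<in>spins V. w \<sigma> * g \<sigma>) / Z\<bar>
     \<le> (\<Sum>i\<in>V. \<delta> i * x i) + \<delta> j * (defect \<rho> j + (\<Sum>i\<in>V. A j i * x i) - x j)"
proof -
  let ?F = "\<Sum>\<sigma>\<in>spins V. w \<sigma> * \<rho> \<sigma>"
  let ?\<delta> = "\<lambda>i. if i = j then 0 else \<delta> i + A i j * \<delta> j"
  have x0: "0 \<le> x i" if "i \<in> V" for i using x that by (simp add: dominates_def)
  have \<delta>0: "0 \<le> \<delta> i" if "i \<in> V" for i
    using lip[OF that] spins_nonempty by (metis abs_ge_zero all_not_in_conv order_trans)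
  have A0: "0 \<le> A i k" if "i \<in> V" "k \<in> V" for i k using A_nonneg that .
  have "\<bar>heat j g \<sigma> - heat j g (flip i \<sigma>)\<bar> \<le> ?\<delta> i" if "i \<in> V" "\<sigma> \<in> spins V" for i \<sigma>
    using heat_lipschitz[OF that(1) j _ that(2) lip] heat_flip[of j g \<sigma>] by auto
  then have 1: "\<bar>(\<Sum>\<sigma>\<in>spins V. w \<sigma> * \<rho> \<sigma> * heat j g \<sigma>) / ?F
      - (\<Sum>\<sigma>\<in>spins V. w \<sigma> * heat j g \<sigma>) / Z\<bar> \<le> (\<Sum>i\<in>V. ?\<delta> i * x i)"
    by (rule dominatesD[OF x])
  have "(\<Sum>i\<in>V. ?\<delta> i * x i) = (\<Sum>i\<in>V-{j}. (\<delta> i + A i j * \<delta> j) * x i)"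
    by (subst sum.remove[OF fin j]) (auto intro!: sum.cong)
  also have "\<dots> = (\<Sum>i\<in>V-{j}. \<delta> i * x i) + \<delta> j * (\<Sum>i\<in>V-{j}. A j i * x i)"
    using A_sym j by (auto simp: sum_distrib_left sum.distrib[symmetric] algebra_simps intro!: sum.cong)
  \<comment> \<open>The nonnegative diagonal term \<open>A j j * x j\<close> is added so that the
    full row of \<open>A\<close> appears.\<close>
  also have "\<dots> \<le> (\<Sum>i\<in>V. \<delta> i * x i) - \<delta> j * x j + \<delta> j * (\<Sum>i\<in>V. A j i * x i)"
    using \<delta>0[OF j] A0[OF j j] x0[OF j]
    by (auto simp: sum.remove[OF fin j] algebra_simps)
  finally have 2: "(\<Sum>i\<in>V. ?\<delta> i * x i)
      \<le> (\<Sum>i\<in>V. \<delta> i * x i) - \<delta> j * x j + \<delta> j * (\<Sum>i\<in>V. A j i * x i)" .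
  have "\<bar>\<Sum>\<sigma>\<in>spins V. w \<sigma> * \<rho> \<sigma> * (g \<sigma> - heat j g \<sigma>)\<bar>
      \<le> (\<Sum>\<sigma>\<in>spins V. w \<sigma> * (\<delta> j * \<bar>\<rho> \<sigma> - \<rho> (flip j \<sigma>)\<bar>)) / 2"
    unfolding sum_heat[OF j] abs_divide
  proof (simp, rule order_trans[OF sum_abs sum_mono])
    fix \<sigma> assume \<sigma>: "\<sigma> \<in> spins V"
    have pos: "0 < w \<sigma>" "0 < w (flip j \<sigma>)" using w_pos \<sigma> by auto
    let ?q = "w (flip j \<sigma>) / (w \<sigma> + w (flip j \<sigma>))"
    have q: "0 \<le> ?q" "?q \<le> 1" using pos by auto
    have "\<bar>w \<sigma> * ?q * ((g \<sigma> - g (flip j \<sigma>)) * (\<rho> \<sigma> - \<rho> (flip j \<sigma>)))\<bar>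
       = w \<sigma> * ?q * (\<bar>g \<sigma> - g (flip j \<sigma>)\<bar> * \<bar>\<rho> \<sigma> - \<rho> (flip j \<sigma>)\<bar>)"
      using pos q by (simp add: abs_mult)
    also have "\<dots> \<le> w \<sigma> * 1 * (\<delta> j * \<bar>\<rho> \<sigma> - \<rho> (flip j \<sigma>)\<bar>)"
      using pos q lip[OF j \<sigma>] \<delta>0[OF j] by (intro mult_mono) auto
    finally show "\<bar>w \<sigma> * w (flip j \<sigma>) * ((g \<sigma> - g (flip j \<sigma>)) * (\<rho> \<sigma> - \<rho> (flip j \<sigma>)))
          / (w \<sigma> + w (flip j \<sigma>))\<bar> \<le> w \<sigma> * (\<delta> j * \<bar>\<rho> \<sigma> - \<rho> (flip j \<sigma>)\<bar>)" by simp
  qed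
  also have "\<dots> = \<delta> j * (\<Sum>\<sigma>\<in>spins V. w \<sigma> * \<bar>\<rho> \<sigma> - \<rho> (flip j \<sigma>)\<bar>) / 2"
    by (simp add: sum_distrib_left algebra_simps)
  \<comment> \<open>The factor 1/2 is given away to keep the constants simple.\<close>
  also have "\<dots> \<le> \<delta> j * (\<Sum>\<sigma>\<in>spins V. w \<sigma> * \<bar>\<rho> \<sigma> - \<rho> (flip j \<sigma>)\<bar>)"
    using \<delta>0[OF j] w_pos by (auto intro!: sum_nonneg mult_nonneg_nonneg simp: less_imp_le)
  finally have "\<bar>\<Sum>\<sigma>\<in>spins V. w \<sigma> * \<rho> \<sigma> * (g \<sigma> - heat j g \<sigma>)\<bar> / ?F \<le> \<delta> j * defect \<rho> j"
    using F by (simp add: defect_def divide_right_mono less_imp_le)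
  then have 3: "\<bar>(\<Sum>\<sigma>\<in>spins V. w \<sigma> * \<rho> \<sigma> * g \<sigma>) / ?F - (\<Sum>\<sigma>\<in>spins V. w \<sigma> * \<rho> \<sigma> * heat j g \<sigma>) / ?F\<bar>
      \<le> \<delta> j * defect \<rho> j"
    using F by (simp add: right_diff_distrib sum_subtractf abs_divide
        flip: diff_divide_distrib)
  show ?thesis using 1 2 3 unfolding sum_heat_1[OF j] by (simp add: algebra_simps)
qed

text \<open>Updating a uniformly chosen site: the average over \<open>j\<close> of the bounds in
  \<open>dominates_step\<close> is again linear in \<open>\<delta>\<close>, and its coefficients
  form the new estimate. It is a lazy step of the affine map that sends \<open>x\<close> to the
  defect plus \<open>A\<close> applied to \<open>x\<close>.\<close>

lemma dominates_average:
  assumes \<rho>: "\<And>\<sigma>. \<sigma> \<in> spins V \<Longrightarrow> 0 \<le> \<rho> \<sigma>" and F: "0 < (\<Sum>\<sigma>\<in>spins V. w \<sigma> * \<rho> \<sigma>)"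
    and x: "dominates \<rho> x" and V: "V \<noteq> {}"
  defines "N \<equiv> real (card V)"
  shows "dominates \<rho> (\<lambda>j. (1 - 1/N) * x j + 1/N * (defect \<rho> j + (\<Sum>i\<in>V. A j i * x i)))"
  unfolding dominates_def
proof (intro conjI ballI allI impI)
  have N: "1 \<le> N" using V fin by (simp add: N_def Suc_leI card_gt_0_iff)
  have x0: "0 \<le> x i" if "i \<in> V" for i using x that by (simp add: dominates_def)
  show "0 \<le> (1 - 1/N) * x j + 1/N * (defect \<rho> j + (\<Sum>i\<in>V. A j i * x i))" if j: "j \<in> V" for j
    using N x0 A_nonneg j F w_pos \<rho>
    by (auto intro!: add_nonneg_nonneg mult_nonneg_nonneg sum_nonneg divide_nonneg_nonneg
        simp: less_imp_le defect_def)
  fix g :: "(nat \<Rightarrow> real) \<Rightarrow> real" and \<delta> :: "nat \<Rightarrow> real"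
  assume "\<forall>j\<in>V. \<forall>\<sigma>\<in>spins V. \<bar>g \<sigma> - g (flip j \<sigma>)\<bar> \<le> \<delta> j"
  then have lip: "\<And>j \<sigma>. j \<in> V \<Longrightarrow> \<sigma> \<in> spins V \<Longrightarrow> \<bar>g \<sigma> - g (flip j \<sigma>)\<bar> \<le> \<delta> j" by blast
  let ?D = "\<bar>(\<Sum>\<sigma>\<in>spins V. w \<sigma> * \<rho> \<sigma> * g \<sigma>) / (\<Sum>\<sigma>\<in>spins V. w \<sigma> * \<rho> \<sigma>)
       - (\<Sum>\<sigma>\<in>spins V. w \<sigma> * g \<sigma>) / Z\<bar>"
  let ?S = "\<Sum>i\<in>V. \<delta> i * x i"
  have "N * ?D = (\<Sum>j\<in>V. ?D)" by (simp add: N_def)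
  also have "\<dots> \<le> (\<Sum>j\<in>V. ?S + \<delta> j * (defect \<rho> j + (\<Sum>i\<in>V. A j i * x i) - x j))"
    by (rule sum_mono) (rule dominates_step[OF \<rho> F x _ lip])
  also have "\<dots> = N * ?S + (\<Sum>j\<in>V. \<delta> j * (defect \<rho> j + (\<Sum>i\<in>V. A j i * x i) - x j))"
    by (simp only: sum.distrib N_def sum_constant of_nat_id)
  also have "\<dots> = N * (\<Sum>j\<in>V. \<delta> j * ((1 - 1/N) * x j + 1/N * (defect \<rho> j + (\<Sum>i\<in>V. A j i * x i))))"
    unfolding sum_distrib_left[of N] sum.distrib[symmetric]
  proof (rule sum.cong[OF refl])
    fix j
    show "N * (\<delta> j * x j) + \<delta> j * (defect \<rho> j + (\<Sum>i\<in>V. A j i * x i) - x j)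
      = N * (\<delta> j * ((1 - 1 / N) * x j + 1 / N * (defect \<rho> j + (\<Sum>i\<in>V. A j i * x i))))"
      using N by (simp add: field_simps)
  qed
  finally show "?D \<le> (\<Sum>j\<in>V. \<delta> j * ((1 - 1/N) * x j + 1/N * (defect \<rho> j + (\<Sum>i\<in>V. A j i * x i))))"
    using N by simp
qed

text \<open>Schur's test. Cauchy-Schwarz with weights \<open>A j i\<close> produces one row sum;
  after exchanging the summations, symmetry of \<open>A\<close> turns the column sums into row sums
  and produces the second factor \<open>1 - \<alpha>\<close>.\<close>

lemma schur:
  assumes x: "\<And>i. i \<in> V \<Longrightarrow> 0 \<le> x i"
  shows "L2_set (\<lambda>j. \<Sum>i\<in>V. A j i * x i) V \<le> (1 - \<alpha>) * L2_set x V"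
proof -
  have \<alpha>': "0 \<le> 1 - \<alpha>" using \<alpha> by simp
  have "(\<Sum>i\<in>V. A j i * x i)\<^sup>2 \<le> (1 - \<alpha>) * (\<Sum>i\<in>V. A j i * (x i)\<^sup>2)" if j: "j \<in> V" for j
  proof -
    have "(\<Sum>i\<in>V. A j i * x i) = (\<Sum>i\<in>V. \<bar>sqrt (A j i)\<bar> * \<bar>sqrt (A j i) * x i\<bar>)"
      using A_nonneg j x by (intro sum.cong) (auto simp: abs_mult)
    also have "\<dots> \<le> L2_set (\<lambda>i. sqrt (A j i)) V * L2_set (\<lambda>i. sqrt (A j i) * x i) V"
      by (rule L2_set_mult_ineq)
    also have "\<dots> = sqrt (\<Sum>i\<in>V. A j i) * sqrt (\<Sum>i\<in>V. A j i * (x i)\<^sup>2)"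
      using A_nonneg j by (simp add: L2_set_def power_mult_distrib cong: sum.cong)
    finally have "(\<Sum>i\<in>V. A j i * x i)\<^sup>2 \<le> (sqrt (\<Sum>i\<in>V. A j i) * sqrt (\<Sum>i\<in>V. A j i * (x i)\<^sup>2))\<^sup>2"
      using A_nonneg j x by (intro power_mono) (auto intro!: sum_nonneg)
    also have "\<dots> = (\<Sum>i\<in>V. A j i) * (\<Sum>i\<in>V. A j i * (x i)\<^sup>2)"
      using A_nonneg j by (simp add: power_mult_distrib sum_nonneg)
    also have "\<dots> \<le> (1 - \<alpha>) * (\<Sum>i\<in>V. A j i * (x i)\<^sup>2)"
      using A_row[OF j] A_nonneg j by (intro mult_right_mono) (auto intro!: sum_nonneg)
    finally show ?thesis .
  qed
  then have "(\<Sum>j\<in>V. (\<Sum>i\<in>V. A j i * x i)\<^sup>2) \<le> (\<Sum>j\<in>V. (1 - \<alpha>) * (\<Sum>i\<in>V. A j i * (x i)\<^sup>2))"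
    by (rule sum_mono)
  also have "\<dots> = (1 - \<alpha>) * (\<Sum>i\<in>V. (\<Sum>j\<in>V. A i j) * (x i)\<^sup>2)"
    unfolding sum_distrib_left[symmetric] sum_distrib_right
    by (subst sum.swap) (intro arg_cong2[where f="(*)"] refl sum.cong, auto simp: A_sym)
  also have "\<dots> \<le> (1 - \<alpha>) * (\<Sum>i\<in>V. (1 - \<alpha>) * (x i)\<^sup>2)"
    using A_row \<alpha>' by (intro mult_left_mono sum_mono mult_right_mono) auto
  also have "\<dots> = (1 - \<alpha>)\<^sup>2 * (\<Sum>i\<in>V. (x i)\<^sup>2)"
    by (simp add: sum_distrib_left power2_eq_square mult.assoc)
  finally have "sqrt (\<Sum>j\<in>V. (\<Sum>i\<in>V. A j i * x i)\<^sup>2) \<le> sqrt ((1 - \<alpha>)\<^sup>2 * (\<Sum>i\<in>V. (x i)\<^sup>2))"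
    by simp
  then show ?thesis using \<alpha>' by (simp add: L2_set_def real_sqrt_mult)
qed

text \<open>One averaged step maps a bound \<open>t\<close> on the norm of \<open>x\<close> to
  \<open>(1 - \<alpha> / N) * t + D / N\<close>, where \<open>D\<close> is the norm of the defect.
  The fixed point is \<open>D / \<alpha>\<close>, and the distance to it shrinks
  geometrically.\<close>

lemma dominates_iterate:
  assumes \<rho>: "\<And>\<sigma>. \<sigma> \<in> spins V \<Longrightarrow> 0 \<le> \<rho> \<sigma>" and F: "0 < (\<Sum>\<sigma>\<in>spins V. w \<sigma> * \<rho> \<sigma>)"
    and V: "V \<noteq> {}"
  defines "N \<equiv> real (card V)"
  shows "\<exists>x. dominates \<rho> x \<and>
     L2_set x V \<le> L2_set (defect \<rho>) V / \<alpha> + (1 - \<alpha> / N) ^ k * L2_set (\<lambda>_. 2) V"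
proof (induction k)
  case 0
  have "0 \<le> L2_set (defect \<rho>) V / \<alpha>" using \<alpha> by (simp add: L2_set_nonneg)
  then have "L2_set (\<lambda>_. 2) V \<le> L2_set (defect \<rho>) V / \<alpha> + (1 - \<alpha> / N) ^ 0 * L2_set (\<lambda>_. 2) V"
    by simp
  with dominates_one[OF \<rho> F] show ?case by (intro exI[of _ "\<lambda>_. 2"] conjI)
next
  case (Suc k)
  have N: "1 \<le> N" using V fin by (simp add: N_def Suc_leI card_gt_0_iff)
  obtain x where x: "dominates \<rho> x"
    and le: "L2_set x V \<le> L2_set (defect \<rho>) V / \<alpha> + (1 - \<alpha> / N) ^ k * L2_set (\<lambda>_. 2) V"
    using Suc.IH by (elim exE conjE)
  let ?x = "\<lambda>j. (1 - 1/N) * x j + 1/N * (defect \<rho> j + (\<Sum>i\<in>V. A j i * x i))"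
  have x0: "0 \<le> x i" if "i \<in> V" for i using x that by (simp add: dominates_def)
  have "L2_set ?x V \<le> L2_set (\<lambda>j. (1 - 1/N) * x j) V + L2_set (\<lambda>j. 1/N * (defect \<rho> j + (\<Sum>i\<in>V. A j i * x i))) V"
    by (rule L2_set_triangle_ineq)
  also have "\<dots> = (1 - 1/N) * L2_set x V + 1/N * L2_set (\<lambda>j. defect \<rho> j + (\<Sum>i\<in>V. A j i * x i)) V"
    using N by (intro arg_cong2[where f = "(+)"] L2_set_right_distrib[symmetric]) auto
  also have "\<dots> \<le> (1 - 1/N) * L2_set x V + 1/N * (L2_set (defect \<rho>) V + (1 - \<alpha>) * L2_set x V)"
    using N schur[of x, OF x0] L2_set_triangle_ineq[of "defect \<rho>" "\<lambda>j. \<Sum>i\<in>V. A j i * x i" V]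
    by (intro add_left_mono mult_left_mono) auto
  also have "\<dots> = (1 - \<alpha> / N) * L2_set x V + L2_set (defect \<rho>) V / N"
    by (simp add: algebra_simps add_divide_distrib diff_divide_distrib)
  also have "\<dots> \<le> (1 - \<alpha> / N) * (L2_set (defect \<rho>) V / \<alpha> + (1 - \<alpha> / N) ^ k * L2_set (\<lambda>_. 2) V)
      + L2_set (defect \<rho>) V / N"
    using le N \<alpha> by (intro add_right_mono mult_left_mono) auto
  also have "\<dots> = L2_set (defect \<rho>) V / \<alpha> + (1 - \<alpha> / N) ^ Suc k * L2_set (\<lambda>_. 2) V"
    using \<alpha> by (simp add: algebra_simps diff_divide_distrib)
  finally have le': "L2_set ?x V \<le> \<dots>" .
  have "dominates \<rho> ?x" using dominates_average[OF \<rho> F x V] by (simp only: N_def)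
  with le' show ?case by (intro exI[of _ ?x] conjI)
qed

text \<open>The coordinate \<open>\<sigma> i\<close> oscillates by 2 at site \<open>i\<close> and
  not at all elsewhere, so any estimate \<open>x\<close> bounds the difference of its two means by
  \<open>2 * x i\<close>.\<close>

lemma marginal_comparison:
  assumes \<rho>: "\<And>\<sigma>. \<sigma> \<in> spins V \<Longrightarrow> 0 \<le> \<rho> \<sigma>" and F: "0 < (\<Sum>\<sigma>\<in>spins V. w \<sigma> * \<rho> \<sigma>)"
  shows "(\<Sum>i\<in>V. ((\<Sum>\<sigma>\<in>spins V. w \<sigma> * \<rho> \<sigma> * \<sigma> i) / (\<Sum>\<sigma>\<in>spins V. w \<sigma> * \<rho> \<sigma>)
       - (\<Sum>\<sigma>\<in>spins V. w \<sigma> * \<sigma> i) / Z)\<^sup>2) \<le> 4 / \<alpha>\<^sup>2 * (\<Sum>i\<in>V. (defect \<rho> i)\<^sup>2)"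
proof (cases "V = {}")
  case False
  define N where "N = real (card V)"
  have N: "1 \<le> N" using False fin by (simp add: N_def Suc_leI card_gt_0_iff)
  let ?m = "\<lambda>i. (\<Sum>\<sigma>\<in>spins V. w \<sigma> * \<rho> \<sigma> * \<sigma> i) / (\<Sum>\<sigma>\<in>spins V. w \<sigma> * \<rho> \<sigma>)
       - (\<Sum>\<sigma>\<in>spins V. w \<sigma> * \<sigma> i) / Z"
  have le: "L2_set ?m V \<le> 2 * (L2_set (defect \<rho>) V / \<alpha> + (1 - \<alpha> / N) ^ k * L2_set (\<lambda>_. 2) V)" for k
  proof -
    obtain x where x: "dominates \<rho> x"
      and lx: "L2_set x V \<le> L2_set (defect \<rho>) V / \<alpha> + (1 - \<alpha> / N) ^ k * L2_set (\<lambda>_. 2) V"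
      using dominates_iterate[OF \<rho> F False, of k] unfolding N_def by blast
    have "\<bar>?m i\<bar> \<le> 2 * x i" if i: "i \<in> V" for i
    proof -
      have "\<bar>?m i\<bar> \<le> (\<Sum>j\<in>V. (if j = i then 2 else 0) * x j)"
      proof (rule dominatesD[OF x])
        fix j \<sigma> assume "j \<in> V" "\<sigma> \<in> spins V"
        then show "\<bar>\<sigma> i - flip j \<sigma> i\<bar> \<le> (if j = i then 2 else 0)"
          using i by (auto simp: flip_def spins_def)
      qed
      also have "\<dots> = (\<Sum>j\<in>V. (if j = i then 2 * x j else 0))" by (rule sum.cong) auto
      finally show ?thesis using i fin by simp
    qed
    then have "L2_set (\<lambda>i. \<bar>?m i\<bar>) V \<le> L2_set (\<lambda>i. 2 * x i) V" by (intro L2_set_mono) auto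
    also have "\<dots> = 2 * L2_set x V" by (simp add: L2_set_right_distrib)
    finally show ?thesis using lx by (simp add: L2_set_def)
  qed
  \<comment> \<open>The number of sites is fixed here, so the contribution of the starting estimate,
    which depends on that number, disappears in the limit.\<close>
  have "(\<lambda>k. 2 * (L2_set (defect \<rho>) V / \<alpha> + (1 - \<alpha> / N) ^ k * L2_set (\<lambda>_. 2) V))
      \<longlonglongrightarrow> 2 * (L2_set (defect \<rho>) V / \<alpha> + 0 * L2_set (\<lambda>_. 2) V)"
    using N \<alpha> by (intro tendsto_intros LIMSEQ_realpow_zero) auto
  then have "L2_set ?m V \<le> 2 * (L2_set (defect \<rho>) V / \<alpha> + 0 * L2_set (\<lambda>_. 2) V)"
    by (rule LIMSEQ_le_const) (intro exI allI impI le)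
  then have "(L2_set ?m V)\<^sup>2 \<le> (2 / \<alpha> * L2_set (defect \<rho>) V)\<^sup>2"
    by (intro power_mono) (auto simp: L2_set_nonneg)
  then show ?thesis
    by (simp add: L2_set_def power_mult_distrib power_divide sum_nonneg)
qed simp

end

section \<open>The logarithmic Sobolev inequality\<close>

text \<open>Up to the factor \<open>\<Sum>\<sigma>\<in>spins V. w \<sigma>\<close> this is the usual
  entropy of \<open>\<rho>\<close> under the normalised measure. Without normalisation, the
  entropies of the two frozen systems simply add in the chain rule.\<close>

definition ent :: "nat set \<Rightarrow> ((nat \<Rightarrow> real) \<Rightarrow> real) \<Rightarrow> ((nat \<Rightarrow> real) \<Rightarrow> real) \<Rightarrow> real" where
  "ent V w \<rho> = (\<Sum>\<sigma>\<in>spins V. w \<sigma> * \<rho> \<sigma> * ln (\<rho> \<sigma>))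
     - (\<Sum>\<sigma>\<in>spins V. w \<sigma> * \<rho> \<sigma>) * ln ((\<Sum>\<sigma>\<in>spins V. w \<sigma> * \<rho> \<sigma>) / (\<Sum>\<sigma>\<in>spins V. w \<sigma>))"

definition energy :: "nat set \<Rightarrow> ((nat \<Rightarrow> real) \<Rightarrow> real) \<Rightarrow> ((nat \<Rightarrow> real) \<Rightarrow> real) \<Rightarrow> nat \<Rightarrow> real" where
  "energy V w u j = (\<Sum>\<sigma>\<in>spins V. w \<sigma> * (u \<sigma> - u (flip j \<sigma>))\<^sup>2)"

text \<open>The two-point entropy is at most the \<open>\<chi>\<^sup>2\<close>-divergence, because \<open>ln x \<le> x - 1\<close>.\<close>

lemma two_point_entropy:
  fixes f1 f2 w1 w2 R :: real
  assumes f: "0 \<le> f1" "0 \<le> f2" "0 < f1 + f2" and w: "0 < w1" "0 < w2"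
    and R: "w1 \<le> R * w2" "w2 \<le> R * w1"
  shows "f1 * ln (f1 / w1) + f2 * ln (f2 / w2) - (f1 + f2) * ln ((f1 + f2) / (w1 + w2))
     \<le> (f1 + f2) * ((1 + R)\<^sup>2 / 4) * ((f1 - f2) / (f1 + f2) - (w1 - w2) / (w1 + w2))\<^sup>2"
proof -
  define F W D where "F = f1 + f2" and "W = w1 + w2" and "D = (f1 * w2 - f2 * w1)\<^sup>2"
  have FW: "0 < F" "0 < W" using f w by (auto simp: F_def W_def)
  \<comment> \<open>Here \<open>g * W / (v * F)\<close> is the ratio of the two normalised masses at
    a point, and the logarithm is linearised at ratio 1.\<close>
  have ln_le: "g * ln (g / v) \<le> g * ln (F / W) + (g\<^sup>2 * W / (v * F) - g)" if "0 \<le> g" "0 < v" for g v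
  proof (cases "g = 0")
    case False
    then have g: "0 < g" using that by simp
    have "ln (g / v) = ln (F / W) + ln (g * W / (v * F))"
      using g that FW by (simp add: ln_div ln_mult)
    also have "ln (g * W / (v * F)) \<le> g * W / (v * F) - 1"
      using g that FW by (intro ln_le_minus_one) simp
    finally have "g * ln (g / v) \<le> g * (ln (F / W) + (g * W / (v * F) - 1))"
      using g by simp
    then show ?thesis by (simp add: algebra_simps power2_eq_square)
  qed simp
  have "f1 * ln (f1 / w1) + f2 * ln (f2 / w2) - F * ln (F / W)
      \<le> f1\<^sup>2 * W / (w1 * F) + f2\<^sup>2 * W / (w2 * F) - F"
    using ln_le[OF f(1) w(1)] ln_le[OF f(2) w(2)] by (simp add: F_def algebra_simps)
  also have "\<dots> = D / (w1 * w2 * F)"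
  proof -
    have "f1\<^sup>2 * W * w2 + f2\<^sup>2 * W * w1 - F * (w1 * w2 * F) = D"
      unfolding F_def W_def D_def by (simp add: algebra_simps power2_eq_square)
    moreover have "f1\<^sup>2 * W / (w1 * F) = f1\<^sup>2 * W * w2 / (w1 * w2 * F)"
      "f2\<^sup>2 * W / (w2 * F) = f2\<^sup>2 * W * w1 / (w1 * w2 * F)"
      "F = F * (w1 * w2 * F) / (w1 * w2 * F)" using w FW by auto
    ultimately show ?thesis by (metis add_divide_distrib diff_divide_distrib)
  qed
  also have "\<dots> = D / F * (1 / (w1 * w2))" by simp
  \<comment> \<open>Comparability of \<open>w1\<close> and \<open>w2\<close> keeps both away from
    zero relative to \<open>W\<close>.\<close>
  also have "\<dots> \<le> D / F * ((1 + R)\<^sup>2 / W\<^sup>2)"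
  proof (rule mult_left_mono)
    have "W \<le> (1 + R) * w2" "W \<le> (1 + R) * w1" using R by (auto simp: W_def algebra_simps)
    then have "W * W \<le> ((1 + R) * w2) * ((1 + R) * w1)" using FW by (intro mult_mono) auto
    then have "W\<^sup>2 \<le> (1 + R)\<^sup>2 * (w1 * w2)" by (simp add: power2_eq_square algebra_simps)
    then show "1 / (w1 * w2) \<le> (1 + R)\<^sup>2 / W\<^sup>2" using w FW by (simp add: divide_simps)
    show "0 \<le> D / F" using FW by (simp add: D_def)
  qed
  also have "\<dots> = F * ((1 + R)\<^sup>2 / 4) * (4 * D / (F\<^sup>2 * W\<^sup>2))"
    using FW by (simp add: power2_eq_square)
  also have "4 * D / (F\<^sup>2 * W\<^sup>2) = (2 * (f1 * w2 - f2 * w1) / (F * W))\<^sup>2"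
    by (simp only: D_def power_divide power_mult_distrib) simp
  \<comment> \<open>The divergence is expressed by the difference of the two mean spins, the
    quantity that \<open>marginal_comparison\<close> controls.\<close>
  also have "2 * (f1 * w2 - f2 * w1) / (F * W) = (f1 - f2) / F - (w1 - w2) / W"
  proof -
    have "(f1 - f2) / F - (w1 - w2) / W = ((f1 - f2) * W - (w1 - w2) * F) / (F * W)"
      using FW by (simp add: diff_frac_eq)
    also have "(f1 - f2) * W - (w1 - w2) * F = 2 * (f1 * w2 - f2 * w1)"
      unfolding F_def W_def by (simp add: algebra_simps)
    finally show ?thesis ..
  qed
  finally show ?thesis by (simp add: F_def W_def)
qed

text \<open>Chain rule: the entropy given spin \<open>i\<close> plus the entropy of the law of spin
  \<open>i\<close>. The logarithms of the masses of the two frozen systems cancel between the two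
  parts.\<close>

lemma ent_chain:
  assumes "i \<in> V"
  shows "ent V w \<rho> = (\<Sum>s\<in>{-1, 1}. ent (V - {i}) (\<lambda>\<sigma>. w (\<sigma>(i := s))) (\<lambda>\<sigma>. \<rho> (\<sigma>(i := s))))
    + ((\<Sum>s\<in>{-1, 1}. (\<Sum>\<sigma>\<in>spins (V - {i}). w (\<sigma>(i := s)) * \<rho> (\<sigma>(i := s)))
          * ln ((\<Sum>\<sigma>\<in>spins (V - {i}). w (\<sigma>(i := s)) * \<rho> (\<sigma>(i := s)))
              / (\<Sum>\<sigma>\<in>spins (V - {i}). w (\<sigma>(i := s)))))
       - (\<Sum>\<sigma>\<in>spins V. w \<sigma> * \<rho> \<sigma>) * ln ((\<Sum>\<sigma>\<in>spins V. w \<sigma> * \<rho> \<sigma>) / (\<Sum>\<sigma>\<in>spins V. w \<sigma>)))"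
  unfolding ent_def sum_spins_split[OF assms, where F = "\<lambda>\<sigma>. w \<sigma> * \<rho> \<sigma> * ln (\<rho> \<sigma>)"]
  by (simp add: sum_subtractf)

lemma energy_split:
  assumes "i \<in> V" "i \<noteq> j"
  shows "(\<Sum>s\<in>{-1, 1}. energy (V - {i}) (\<lambda>\<sigma>. w (\<sigma>(i := s))) (\<lambda>\<sigma>. u (\<sigma>(i := s))) j) = energy V w u j"
  unfolding energy_def sum_spins_split[OF assms(1), where F = "\<lambda>\<sigma>. w \<sigma> * (u \<sigma> - u (flip j \<sigma>))\<^sup>2"]
  using assms(2) by (simp add: flip_fun_upd)

section \<open>Ingredients of the induction for the logarithmic Sobolev inequality\<close>

context weak_dep
begin

lemma energy_nonneg: "0 \<le> energy V w u j"
  unfolding energy_def by (intro sum_nonneg mult_nonneg_nonneg) (auto simp: less_imp_le w_pos)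

lemma R_nonneg: "V \<noteq> {} \<Longrightarrow> 0 \<le> R"
proof -
  assume "V \<noteq> {}"
  then obtain i where i: "i \<in> V" by blast
  obtain \<sigma> where \<sigma>: "\<sigma> \<in> spins V" using spins_nonempty by blast
  have "0 < R * w \<sigma>" using ratio[OF i \<sigma>] w_pos[of "flip i \<sigma>"] \<sigma> by simp
  then show ?thesis using w_pos[OF \<sigma>] by (simp add: zero_less_mult_iff)
qed

lemma sum_flip_le:
  assumes j: "j \<in> V" and g: "\<And>\<sigma>. \<sigma> \<in> spins V \<Longrightarrow> 0 \<le> g \<sigma>"
  shows "(\<Sum>\<sigma>\<in>spins V. w \<sigma> * g (flip j \<sigma>)) \<le> R * (\<Sum>\<sigma>\<in>spins V. w \<sigma> * g \<sigma>)"
proof -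
  have "(\<Sum>\<sigma>\<in>spins V. w \<sigma> * g (flip j \<sigma>)) = (\<Sum>\<sigma>\<in>spins V. w (flip j \<sigma>) * g \<sigma>)"
    using sum_flip[of "\<lambda>\<sigma>. w (flip j \<sigma>) * g \<sigma>" j V] by simp
  also have "\<dots> \<le> (\<Sum>\<sigma>\<in>spins V. R * w \<sigma> * g \<sigma>)"
    using ratio j g by (intro sum_mono mult_right_mono) auto
  finally show ?thesis by (simp add: sum_distrib_left mult.assoc)
qed

text \<open>Factor the difference of squares and apply Cauchy-Schwarz: one factor is the energy of
  \<open>u\<close>, the other is at most \<open>2 * (1 + R)\<close> times the total mass of
  \<open>u\<close> squared.\<close>

lemma defect_square:
  assumes F: "0 < (\<Sum>\<sigma>\<in>spins V. w \<sigma> * (u \<sigma>)\<^sup>2)" and j: "j \<in> V"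
  shows "(defect (\<lambda>\<sigma>. (u \<sigma>)\<^sup>2) j)\<^sup>2 \<le> 2 * (1 + R) / (\<Sum>\<sigma>\<in>spins V. w \<sigma> * (u \<sigma>)\<^sup>2) * energy V w u j"
proof -
  let ?F = "\<Sum>\<sigma>\<in>spins V. w \<sigma> * (u \<sigma>)\<^sup>2"
  let ?S = "\<Sum>\<sigma>\<in>spins V. w \<sigma> * \<bar>(u \<sigma>)\<^sup>2 - (u (flip j \<sigma>))\<^sup>2\<bar>"
  let ?T = "\<Sum>\<sigma>\<in>spins V. w \<sigma> * (u \<sigma> + u (flip j \<sigma>))\<^sup>2"
  have wp: "0 \<le> w \<sigma>" if "\<sigma> \<in> spins V" for \<sigma> using w_pos[OF that] by simp
  have "?S = (\<Sum>\<sigma>\<in>spins V. \<bar>sqrt (w \<sigma>) * (u \<sigma> - u (flip j \<sigma>))\<bar> * \<bar>sqrt (w \<sigma>) * (u \<sigma> + u (flip j \<sigma>))\<bar>)"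
  proof (rule sum.cong[OF refl])
    fix \<sigma> assume \<sigma>: "\<sigma> \<in> spins V"
    have "(u \<sigma>)\<^sup>2 - (u (flip j \<sigma>))\<^sup>2 = (u \<sigma> - u (flip j \<sigma>)) * (u \<sigma> + u (flip j \<sigma>))"
      by (simp add: power2_eq_square algebra_simps)
    moreover have "w \<sigma> = sqrt (w \<sigma>) * sqrt (w \<sigma>)" using wp[OF \<sigma>] by simp
    ultimately show "w \<sigma> * \<bar>(u \<sigma>)\<^sup>2 - (u (flip j \<sigma>))\<^sup>2\<bar>
        = \<bar>sqrt (w \<sigma>) * (u \<sigma> - u (flip j \<sigma>))\<bar> * \<bar>sqrt (w \<sigma>) * (u \<sigma> + u (flip j \<sigma>))\<bar>"
      using wp[OF \<sigma>] by (simp add: abs_mult)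
  qed
  also have "\<dots> \<le> L2_set (\<lambda>\<sigma>. sqrt (w \<sigma>) * (u \<sigma> - u (flip j \<sigma>))) (spins V)
      * L2_set (\<lambda>\<sigma>. sqrt (w \<sigma>) * (u \<sigma> + u (flip j \<sigma>))) (spins V)"
    by (rule L2_set_mult_ineq)
  also have "\<dots> = sqrt (energy V w u j) * sqrt ?T"
    using wp by (simp add: L2_set_def power_mult_distrib energy_def cong: sum.cong)
  finally have "?S\<^sup>2 \<le> (sqrt (energy V w u j) * sqrt ?T)\<^sup>2"
    using wp by (intro power_mono sum_nonneg) auto
  also have "\<dots> = energy V w u j * ?T"
    using energy_nonneg wp by (simp add: power_mult_distrib sum_nonneg)
  also have "?T \<le> 2 * (1 + R) * ?F"
  proof -
    have "?T \<le> (\<Sum>\<sigma>\<in>spins V. w \<sigma> * (2 * (u \<sigma>)\<^sup>2 + 2 * (u (flip j \<sigma>))\<^sup>2))"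
    proof (intro sum_mono mult_left_mono wp)
      fix \<sigma>
      have "0 \<le> (u \<sigma> - u (flip j \<sigma>))\<^sup>2" by simp
      then show "(u \<sigma> + u (flip j \<sigma>))\<^sup>2 \<le> 2 * (u \<sigma>)\<^sup>2 + 2 * (u (flip j \<sigma>))\<^sup>2"
        by (simp add: power2_eq_square algebra_simps)
    qed
    also have "\<dots> = 2 * ?F + 2 * (\<Sum>\<sigma>\<in>spins V. w \<sigma> * (u (flip j \<sigma>))\<^sup>2)"
      by (simp add: sum_distrib_left sum.distrib[symmetric] algebra_simps)
    also have "\<dots> \<le> 2 * ?F + 2 * (R * ?F)"
      using sum_flip_le[OF j, of "\<lambda>\<sigma>. (u \<sigma>)\<^sup>2"] by simp
    finally show ?thesis by (simp add: algebra_simps)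
  qed
  finally have "?S\<^sup>2 / ?F\<^sup>2 \<le> energy V w u j * (2 * (1 + R) * ?F) / ?F\<^sup>2"
    using energy_nonneg by (intro divide_right_mono) (auto intro: mult_left_mono)
  also have "\<dots> = 2 * (1 + R) / ?F * energy V w u j"
    using F by (simp add: power2_eq_square)
  finally show ?thesis by (simp add: defect_def power_divide)
qed

text \<open>The law of spin \<open>i\<close> lives on two points with masses \<open>f s\<close> and
  \<open>v s\<close>. The ratio bound passes to \<open>v\<close> by summation over the other spins,
  so \<open>two_point_entropy\<close> applies.\<close>

lemma marginal_entropy:
  assumes i: "i \<in> V" and \<rho>: "\<And>\<sigma>. \<sigma> \<in> spins V \<Longrightarrow> 0 \<le> \<rho> \<sigma>"
    and F: "0 < (\<Sum>\<sigma>\<in>spins V. w \<sigma> * \<rho> \<sigma>)"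
  shows "(\<Sum>s\<in>{-1, 1}. (\<Sum>\<sigma>\<in>spins (V - {i}). w (\<sigma>(i := s)) * \<rho> (\<sigma>(i := s)))
          * ln ((\<Sum>\<sigma>\<in>spins (V - {i}). w (\<sigma>(i := s)) * \<rho> (\<sigma>(i := s)))
              / (\<Sum>\<sigma>\<in>spins (V - {i}). w (\<sigma>(i := s)))))
       - (\<Sum>\<sigma>\<in>spins V. w \<sigma> * \<rho> \<sigma>) * ln ((\<Sum>\<sigma>\<in>spins V. w \<sigma> * \<rho> \<sigma>) / (\<Sum>\<sigma>\<in>spins V. w \<sigma>))
    \<le> (\<Sum>\<sigma>\<in>spins V. w \<sigma> * \<rho> \<sigma>) * ((1 + R)\<^sup>2 / 4)
        * ((\<Sum>\<sigma>\<in>spins V. w \<sigma> * \<rho> \<sigma> * \<sigma> i) / (\<Sum>\<sigma>\<in>spins V. w \<sigma> * \<rho> \<sigma>)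
           - (\<Sum>\<sigma>\<in>spins V. w \<sigma> * \<sigma> i) / Z)\<^sup>2"
proof -
  define f where "f s = (\<Sum>\<sigma>\<in>spins (V - {i}). w (\<sigma>(i := s)) * \<rho> (\<sigma>(i := s)))" for s
  define v where "v s = (\<Sum>\<sigma>\<in>spins (V - {i}). w (\<sigma>(i := s)))" for s
  note upd = fun_upd_in_spins[OF i]
  have f: "0 \<le> f s" if "s \<in> {-1, 1}" for s
    unfolding f_def using \<rho> w_pos upd[OF that] by (intro sum_nonneg mult_nonneg_nonneg) (auto simp: less_imp_le)
  have v: "0 < v s" if "s \<in> {-1, 1}" for s
    unfolding v_def using w_pos upd[OF that] by (intro sum_pos finite_spins spins_nonempty) (auto simp: fin)
  have vR: "v (- s) \<le> R * v s" if "s \<in> {-1, 1}" for s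
    unfolding v_def sum_distrib_left
  proof (rule sum_mono)
    fix \<sigma> assume \<sigma>: "\<sigma> \<in> spins (V - {i})"
    have "flip i (\<sigma>(i := s)) = \<sigma>(i := - s)" by (simp add: flip_def)
    then show "w (\<sigma>(i := - s)) \<le> R * w (\<sigma>(i := s))"
      using ratio[OF i upd[OF that \<sigma>]] by simp
  qed
  have Fs: "(\<Sum>\<sigma>\<in>spins V. w \<sigma> * \<rho> \<sigma>) = f 1 + f (-1)"
    unfolding f_def sum_spins_split[OF i, where F = "\<lambda>\<sigma>. w \<sigma> * \<rho> \<sigma>"] by simp
  have Zs: "(\<Sum>\<sigma>\<in>spins V. w \<sigma>) = v 1 + v (-1)"
    unfolding v_def sum_spins_split[OF i, where F = w] by simp
  have Fi: "(\<Sum>\<sigma>\<in>spins V. w \<sigma> * \<rho> \<sigma> * \<sigma> i) = f 1 - f (-1)"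
    unfolding f_def sum_spins_split[OF i, where F = "\<lambda>\<sigma>. w \<sigma> * \<rho> \<sigma> * \<sigma> i"] by (simp add: sum_negf)
  have Zi: "(\<Sum>\<sigma>\<in>spins V. w \<sigma> * \<sigma> i) = v 1 - v (-1)"
    unfolding v_def sum_spins_split[OF i, where F = "\<lambda>\<sigma>. w \<sigma> * \<sigma> i"] by (simp add: sum_negf)
  show ?thesis
    using two_point_entropy[of "f 1" "f (-1)" "v 1" "v (-1)" R] f v vR[of 1] vR[of "-1"] F
    unfolding Z_def Fs Zs Fi Zi f_def[symmetric] v_def[symmetric] by (simp add: add.commute)
qed

end

text \<open>The degenerate case, kept apart because the defect and the means of the spins divide by
  the total mass.\<close>

lemma ent_eq_0:
  assumes "finite V" "\<And>\<sigma>. \<sigma> \<in> spins V \<Longrightarrow> 0 < w \<sigma>"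
    and "(\<Sum>\<sigma>\<in>spins V. w \<sigma> * (u \<sigma>)\<^sup>2) = 0"
  shows "ent V w (\<lambda>\<sigma>. (u \<sigma>)\<^sup>2) = 0"
proof -
  have "\<forall>\<sigma>\<in>spins V. w \<sigma> * (u \<sigma>)\<^sup>2 = 0"
    using assms by (subst sum_nonneg_eq_0_iff[symmetric]) (auto simp: finite_spins less_imp_le)
  then have "(\<Sum>\<sigma>\<in>spins V. w \<sigma> * (u \<sigma>)\<^sup>2 * ln ((u \<sigma>)\<^sup>2)) = 0"
    by (intro sum.neutral) auto
  then show ?thesis by (simp add: ent_def assms(3))
qed

text \<open>For each frozen site \<open>i\<close> the induction hypothesis yields the energy without
  its part at \<open>i\<close>. Summed over \<open>i\<close>, exactly one copy of the total energy
  is missing, and the marginal terms sum to at most that copy times the constant. Hence the constant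
  does not grow.\<close>

lemma log_sobolev:
  assumes "weak_dep V A R \<alpha> w"
  shows "ent V w (\<lambda>\<sigma>. (u \<sigma>)\<^sup>2) \<le> 2 * (1 + R) ^ 3 / \<alpha>\<^sup>2 * (\<Sum>j\<in>V. energy V w u j)"
  using assms
proof (induction "card V" arbitrary: V w u)
  case 0
  then interpret weak_dep V A R \<alpha> w by simp
  have V: "V = {}" using 0 fin by simp
  have "0 < w (\<lambda>_. 0)" using w_pos[of "\<lambda>_. 0"] by (simp add: V spins_empty)
  then show ?case by (simp add: V ent_def spins_empty)
next
  case (Suc N)
  interpret weak_dep V A R \<alpha> w by fact
  let ?\<rho> = "\<lambda>\<sigma>. (u \<sigma>)\<^sup>2"
  let ?C = "2 * (1 + R) ^ 3 / \<alpha>\<^sup>2" and ?E = "\<Sum>j\<in>V. energy V w u j"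
  let ?F = "\<Sum>\<sigma>\<in>spins V. w \<sigma> * ?\<rho> \<sigma>"
  have V: "V \<noteq> {}" using Suc.hyps by auto
  have E0: "0 \<le> ?E" by (intro sum_nonneg energy_nonneg)
  have R: "0 \<le> R" by (rule R_nonneg[OF V])
  have "0 \<le> ?F" by (intro sum_nonneg mult_nonneg_nonneg) (auto simp: less_imp_le w_pos)
  then consider "?F = 0" | "0 < ?F" by linarith
  then show ?case
  proof cases
    case 1
    then show ?thesis using ent_eq_0[OF fin w_pos 1] E0 R by simp
  next
    case 2
    let ?m = "\<lambda>i. (\<Sum>\<sigma>\<in>spins V. w \<sigma> * ?\<rho> \<sigma> * \<sigma> i) / ?F - (\<Sum>\<sigma>\<in>spins V. w \<sigma> * \<sigma> i) / Z"
    have step: "ent V w ?\<rho> \<le> ?C * (?E - energy V w u i) + ?F * ((1 + R)\<^sup>2 / 4) * (?m i)\<^sup>2"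
      if i: "i \<in> V" for i
    proof -
      let ?w = "\<lambda>s \<sigma>. w (\<sigma>(i := s))" and ?u = "\<lambda>s \<sigma>. u (\<sigma>(i := s))"
      have N: "N = card (V - {i})" using Suc.hyps i fin by simp
      have "(\<Sum>s\<in>{-1, 1}. ent (V - {i}) (?w s) (\<lambda>\<sigma>. (?u s \<sigma>)\<^sup>2))
          \<le> (\<Sum>s\<in>{-1, 1}. ?C * (\<Sum>j\<in>V - {i}. energy (V - {i}) (?w s) (?u s) j))"
        by (intro sum_mono Suc.hyps(1)[OF N] freeze[OF i])
      also have "\<dots> = ?C * (\<Sum>j\<in>V - {i}. \<Sum>s\<in>{-1, 1}. energy (V - {i}) (?w s) (?u s) j)"
        by (subst sum.swap) (simp only: sum_distrib_left)
      also have "(\<Sum>j\<in>V - {i}. \<Sum>s\<in>{-1, 1}. energy (V - {i}) (?w s) (?u s) j)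
          = (\<Sum>j\<in>V - {i}. energy V w u j)"
        by (intro sum.cong refl energy_split i) auto
      also have "\<dots> = ?E - energy V w u i" using i fin by (simp add: sum_diff1)
      finally show ?thesis
        unfolding ent_chain[OF i, of w ?\<rho>]
        by (rule add_mono) (rule marginal_entropy[OF i zero_le_power2 2])
    qed
    have "(\<Sum>i\<in>V. (defect ?\<rho> i)\<^sup>2) \<le> (\<Sum>i\<in>V. 2 * (1 + R) / ?F * energy V w u i)"
      by (intro sum_mono defect_square 2)
    also have "\<dots> = 2 * (1 + R) / ?F * ?E" by (simp only: sum_distrib_left)
    finally have "4 / \<alpha>\<^sup>2 * (\<Sum>i\<in>V. (defect ?\<rho> i)\<^sup>2) \<le> 4 / \<alpha>\<^sup>2 * (2 * (1 + R) / ?F * ?E)"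
      by (rule mult_left_mono) simp
    moreover have "(\<Sum>i\<in>V. (?m i)\<^sup>2) \<le> 4 / \<alpha>\<^sup>2 * (\<Sum>i\<in>V. (defect ?\<rho> i)\<^sup>2)"
      by (rule marginal_comparison) (use 2 in auto)
    ultimately have m: "(\<Sum>i\<in>V. (?m i)\<^sup>2) \<le> 4 / \<alpha>\<^sup>2 * (2 * (1 + R) / ?F * ?E)" by linarith
    have "real (card V) * ent V w ?\<rho> = (\<Sum>i\<in>V. ent V w ?\<rho>)" by simp
    also have "\<dots> \<le> (\<Sum>i\<in>V. ?C * (?E - energy V w u i) + ?F * ((1 + R)\<^sup>2 / 4) * (?m i)\<^sup>2)"
      by (intro sum_mono step)
    also have "\<dots> = ?C * (real (card V) * ?E - ?E) + ?F * ((1 + R)\<^sup>2 / 4) * (\<Sum>i\<in>V. (?m i)\<^sup>2)"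
      by (simp only: sum.distrib sum_subtractf sum_constant sum_distrib_left[symmetric])
    also have "\<dots> \<le> ?C * (real (card V) * ?E - ?E)
        + ?F * ((1 + R)\<^sup>2 / 4) * (4 / \<alpha>\<^sup>2 * (2 * (1 + R) / ?F * ?E))"
      using 2 by (intro add_left_mono mult_left_mono m) auto
    \<comment> \<open>The constant \<open>?C\<close> is chosen to make this an identity.\<close>
    also have "?F * ((1 + R)\<^sup>2 / 4) * (4 / \<alpha>\<^sup>2 * (2 * (1 + R) / ?F * ?E)) = ?C * ?E"
      using 2 by (simp add: power2_eq_square power3_eq_cube)
    finally have "real (card V) * ent V w ?\<rho> \<le> real (card V) * (?C * ?E)"
      by (simp add: right_diff_distrib mult.left_commute)
    moreover have "0 < real (card V)" using Suc.hyps by (metis of_nat_0_less_iff zero_less_Suc)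
    ultimately show ?thesis by (simp only: mult_le_cancel_left_pos)
  qed
qed

section \<open>Moment inequalities\<close>

text \<open>The mean value bound uses the power of the larger argument; adding the power of the
  smaller one makes the bound symmetric, which suits a sum over both ends of a flip.\<close>

lemma power_diff_square_le:
  fixes x y :: real
  assumes "0 \<le> x" "0 \<le> y" "1 \<le> m"
  shows "(x ^ m - y ^ m)\<^sup>2 \<le> (real m)\<^sup>2 * (x - y)\<^sup>2 * (x ^ (2 * m - 2) + y ^ (2 * m - 2))"
proof -
  have diff: "s ^ m - t ^ m \<le> real m * (s - t) * s ^ (m - 1)" if "0 \<le> t" "t \<le> s" for s t :: real
    using \<open>1 \<le> m\<close>
  proof (induction m rule: dec_induct)
    case (step m)
    have "s ^ Suc m - t ^ Suc m = s * (s ^ m - t ^ m) + (s - t) * t ^ m" by (simp add: algebra_simps)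
    also have "\<dots> \<le> s * (real m * (s - t) * s ^ (m - 1)) + (s - t) * s ^ m"
      using that step by (intro add_mono mult_left_mono power_mono) auto
    also have "s * (real m * (s - t) * s ^ (m - 1)) = real m * (s - t) * s ^ m"
      using step.hyps by (cases m) (auto simp: algebra_simps)
    finally show ?case by (simp add: algebra_simps)
  qed simp
  have sq: "(s ^ m - t ^ m)\<^sup>2 \<le> (real m)\<^sup>2 * (s - t)\<^sup>2 * (s ^ (2 * m - 2) + t ^ (2 * m - 2))"
    if "0 \<le> t" "t \<le> s" for s t :: real
  proof -
    have "(s ^ m - t ^ m)\<^sup>2 \<le> (real m * (s - t) * s ^ (m - 1))\<^sup>2"
      using that by (intro power_mono diff) (auto intro: power_mono)
    also have "\<dots> = (real m)\<^sup>2 * (s - t)\<^sup>2 * s ^ (2 * m - 2)"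
    proof -
      have "(m - 1) * 2 = 2 * m - 2" by simp
      then show ?thesis by (simp only: power_mult_distrib power_mult[symmetric])
    qed
    also have "\<dots> \<le> (real m)\<^sup>2 * (s - t)\<^sup>2 * (s ^ (2 * m - 2) + t ^ (2 * m - 2))"
      using that by (intro mult_left_mono) auto
    finally show ?thesis .
  qed
  show ?thesis
  proof (cases "y \<le> x")
    case False
    then show ?thesis using sq[of x y] assms by (simp add: power2_commute add.commute)
  qed (use sq assms in auto)
qed

lemma power_split_square: "2 \<le> p \<Longrightarrow> (t :: real) ^ p = t ^ (p - 2) * t\<^sup>2"
  by (metis power_add le_add_diff_inverse2)

text \<open>Replace the smaller of the two bases by the larger one.\<close>

lemma young_power:
  fixes x z :: real
  assumes "0 \<le> x" "0 \<le> z" "2 \<le> p"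
  shows "x ^ (p - 2) * z\<^sup>2 \<le> x ^ p + z ^ p"
proof -
  note p = power_split_square[OF assms(3)]
  consider "x \<le> z" | "z \<le> x" by linarith
  then have "x ^ (p - 2) * z\<^sup>2 \<le> z ^ p \<or> x ^ (p - 2) * z\<^sup>2 \<le> x ^ p"
    unfolding p using assms by cases (auto intro!: mult_right_mono mult_left_mono power_mono)
  moreover have "0 \<le> x ^ p" "0 \<le> z ^ p" using assms by auto
  ultimately show ?thesis by linarith
qed

text \<open>The factor 1/2 matches the \<open>sqrt 2\<close> in \<open>hdiff\<close>, so that on
  \<open>{..<n}\<close> this is the tensor norm of order one.\<close>

definition grad :: "nat set \<Rightarrow> ((nat \<Rightarrow> real) \<Rightarrow> real) \<Rightarrow> (nat \<Rightarrow> real) \<Rightarrow> real" where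
  "grad V g \<sigma> = sqrt (\<Sum>j\<in>V. (g \<sigma> - g (flip j \<sigma>))\<^sup>2 / 2)"

lemma grad_nonneg: "0 \<le> grad V g \<sigma>"
  by (simp add: grad_def sum_nonneg)

lemma grad_square: "(grad V g \<sigma>)\<^sup>2 = (\<Sum>j\<in>V. (g \<sigma> - g (flip j \<sigma>))\<^sup>2) / 2"
  by (simp add: grad_def sum_nonneg sum_divide_distrib)

definition lsi_const :: "real \<Rightarrow> real \<Rightarrow> real" where
  "lsi_const R \<alpha> = 2 * (1 + R) ^ 3 / \<alpha>\<^sup>2"

text \<open>Collects the constants of \<open>moment_double\<close>: the logarithmic Sobolev
  constant, the factor \<open>2 * (1 + R)\<close> of \<open>energy_power\<close>, and a 2 from
  Young's inequality.\<close>

definition moment_const :: "real \<Rightarrow> real \<Rightarrow> real" where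
  "moment_const R \<alpha> = 4 * lsi_const R \<alpha> * (1 + R)"

section \<open>Normalised means, entropy bounds, and growth of moments\<close>

context weak_dep
begin

definition mean :: "((nat \<Rightarrow> real) \<Rightarrow> real) \<Rightarrow> real" where
  "mean g = (\<Sum>\<sigma>\<in>spins V. w \<sigma> * g \<sigma>) / Z"

lemma mean_mono: "(\<And>\<sigma>. \<sigma> \<in> spins V \<Longrightarrow> g \<sigma> \<le> g' \<sigma>) \<Longrightarrow> mean g \<le> mean g'"
  unfolding mean_def using Z_pos w_pos
  by (intro divide_right_mono sum_mono mult_left_mono) (auto simp: less_imp_le)

lemma mean_cong: "(\<And>\<sigma>. \<sigma> \<in> spins V \<Longrightarrow> g \<sigma> = g' \<sigma>) \<Longrightarrow> mean g = mean g'"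
  by (simp add: mean_def)

lemma mean_const [simp]: "mean (\<lambda>_. c) = c"
  using Z_pos by (simp add: mean_def Z_def sum_distrib_right[symmetric])

lemma mean_add: "mean (\<lambda>\<sigma>. g \<sigma> + g' \<sigma>) = mean g + mean g'"
  by (simp add: mean_def sum.distrib add_divide_distrib distrib_left)

lemma mean_diff: "mean (\<lambda>\<sigma>. g \<sigma> - g' \<sigma>) = mean g - mean g'"
  by (simp add: mean_def sum_subtractf diff_divide_distrib right_diff_distrib)

lemma mean_cmult: "mean (\<lambda>\<sigma>. c * g \<sigma>) = c * mean g"
  by (simp add: mean_def sum_distrib_left mult.left_commute)

lemma mean_nonneg: "(\<And>\<sigma>. \<sigma> \<in> spins V \<Longrightarrow> 0 \<le> g \<sigma>) \<Longrightarrow> 0 \<le> mean g"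
  using mean_mono[of "\<lambda>_. 0" g] by simp

lemma mean_le_const: "(\<And>\<sigma>. \<sigma> \<in> spins V \<Longrightarrow> g \<sigma> \<le> c) \<Longrightarrow> mean g \<le> c"
  using mean_mono[of g "\<lambda>_. c"] by simp

lemma variance_eq: "mean (\<lambda>\<sigma>. (g \<sigma> - mean g)\<^sup>2) = mean (\<lambda>\<sigma>. (g \<sigma>)\<^sup>2) - (mean g)\<^sup>2"
proof -
  have "mean (\<lambda>\<sigma>. (g \<sigma> - mean g)\<^sup>2) = mean (\<lambda>\<sigma>. ((g \<sigma>)\<^sup>2 - 2 * mean g * g \<sigma>) + (mean g)\<^sup>2)"
    by (intro mean_cong) (simp add: power2_eq_square algebra_simps)
  also have "\<dots> = mean (\<lambda>\<sigma>. (g \<sigma>)\<^sup>2) - 2 * mean g * mean g + (mean g)\<^sup>2"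
    by (simp only: mean_add mean_diff mean_cmult mean_const)
  finally show ?thesis by (simp add: power2_eq_square)
qed

lemma mean_square_le: "(mean g)\<^sup>2 \<le> mean (\<lambda>\<sigma>. (g \<sigma>)\<^sup>2)"
  using variance_eq[of g] mean_nonneg[of "\<lambda>\<sigma>. (g \<sigma> - mean g)\<^sup>2"] by simp

text \<open>Cauchy-Schwarz halves the exponent; this is monotonicity of the norms along powers of
  two.\<close>

lemma moment_antimono:
  assumes "0 \<le> c" "j \<le> k" and g: "\<And>\<sigma>. \<sigma> \<in> spins V \<Longrightarrow> 0 \<le> g \<sigma>"
    and le: "mean (\<lambda>\<sigma>. g \<sigma> ^ (2 ^ k)) \<le> c ^ (2 ^ k)"
  shows "mean (\<lambda>\<sigma>. g \<sigma> ^ (2 ^ j)) \<le> c ^ (2 ^ j)"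
  using \<open>j \<le> k\<close>
proof (induction j rule: inc_induct)
  case (step j)
  have "(mean (\<lambda>\<sigma>. g \<sigma> ^ 2 ^ j))\<^sup>2 \<le> mean (\<lambda>\<sigma>. (g \<sigma> ^ 2 ^ j)\<^sup>2)" by (rule mean_square_le)
  also have "\<dots> = mean (\<lambda>\<sigma>. g \<sigma> ^ 2 ^ Suc j)" by (simp add: power_mult[symmetric] mult.commute)
  also have "\<dots> \<le> c ^ 2 ^ Suc j" by (rule step.IH)
  also have "\<dots> = (c ^ 2 ^ j)\<^sup>2" by (simp add: power_mult[symmetric] mult.commute)
  finally show ?case by (rule power2_le_imp_le) (use assms(1) in simp)
qed (rule le)

text \<open>Jensen's inequality for the logarithm under the density proportional to \<open>u\<close>
  squared, whose mean of \<open>1 / u\<close> is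
  \<open>mean u / mean (\<lambda>\<sigma>. (u \<sigma>)\<^sup>2)\<close>. It is carried out
  pointwise by a tangent line, which also covers points where \<open>u\<close> vanishes.\<close>

lemma ent_lower:
  assumes u: "\<And>\<sigma>. \<sigma> \<in> spins V \<Longrightarrow> 0 \<le> u \<sigma>"
    and pos: "0 < mean u" "0 < mean (\<lambda>\<sigma>. (u \<sigma>)\<^sup>2)"
  shows "mean (\<lambda>\<sigma>. (u \<sigma>)\<^sup>2) * ln (mean (\<lambda>\<sigma>. (u \<sigma>)\<^sup>2) / (mean u)\<^sup>2) \<le> ent V w (\<lambda>\<sigma>. (u \<sigma>)\<^sup>2) / Z"
proof -
  let ?a = "mean u" and ?b = "mean (\<lambda>\<sigma>. (u \<sigma>)\<^sup>2)"
  have "mean (\<lambda>\<sigma>. (2 * ln ?b - 2 * ln ?a + 2) * (u \<sigma>)\<^sup>2 - 2 * ?b / ?a * u \<sigma>)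
      \<le> mean (\<lambda>\<sigma>. (u \<sigma>)\<^sup>2 * ln ((u \<sigma>)\<^sup>2))"
  proof (rule mean_mono)
    fix \<sigma> assume \<sigma>: "\<sigma> \<in> spins V"
    show "(2 * ln ?b - 2 * ln ?a + 2) * (u \<sigma>)\<^sup>2 - 2 * ?b / ?a * u \<sigma> \<le> (u \<sigma>)\<^sup>2 * ln ((u \<sigma>)\<^sup>2)"
    proof (cases "u \<sigma> = 0")
      case False
      then have u0: "0 < u \<sigma>" using u[OF \<sigma>] by simp
      have "ln (?b / (u \<sigma> * ?a)) \<le> ?b / (u \<sigma> * ?a) - 1"
        using u0 pos by (intro ln_le_minus_one) simp
      then have "ln ?b - ln (u \<sigma>) - ln ?a \<le> ?b / (u \<sigma> * ?a) - 1"
        using u0 pos by (simp add: ln_div ln_mult)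
      then have "2 * (u \<sigma>)\<^sup>2 * (ln ?b - ln (u \<sigma>) - ln ?a) \<le> 2 * (u \<sigma>)\<^sup>2 * (?b / (u \<sigma> * ?a) - 1)"
        by (intro mult_left_mono) auto
      moreover have "2 * (u \<sigma>)\<^sup>2 * (?b / (u \<sigma> * ?a) - 1) = 2 * ?b / ?a * u \<sigma> - 2 * (u \<sigma>)\<^sup>2"
        using u0 by (simp add: right_diff_distrib power2_eq_square)
      ultimately show ?thesis using u0 by (simp add: ln_realpow algebra_simps)
    qed simp
  qed
  then have "(2 * ln ?b - 2 * ln ?a + 2) * ?b - 2 * ?b / ?a * ?a \<le> mean (\<lambda>\<sigma>. (u \<sigma>)\<^sup>2 * ln ((u \<sigma>)\<^sup>2))"
    by (simp only: mean_diff mean_cmult)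
  then have le: "(2 * ln ?b - 2 * ln ?a) * ?b \<le> mean (\<lambda>\<sigma>. (u \<sigma>)\<^sup>2 * ln ((u \<sigma>)\<^sup>2))"
    using pos by (simp add: algebra_simps)
  have ent: "ent V w (\<lambda>\<sigma>. (u \<sigma>)\<^sup>2) / Z = mean (\<lambda>\<sigma>. (u \<sigma>)\<^sup>2 * ln ((u \<sigma>)\<^sup>2)) - ?b * ln ?b"
    by (simp add: ent_def mean_def Z_def diff_divide_distrib mult.assoc)
  have ln: "ln (?b / ?a\<^sup>2) = ln ?b - 2 * ln ?a"
    using pos by (simp add: ln_div ln_realpow)
  show ?thesis unfolding ent ln using le by (simp add: algebra_simps)
qed

abbreviation "CL \<equiv> lsi_const R \<alpha>"
abbreviation "K \<equiv> moment_const R \<alpha>"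

lemma ent_upper:
  "ent V w (\<lambda>\<sigma>. (u \<sigma>)\<^sup>2) / Z \<le> CL * ((\<Sum>j\<in>V. energy V w u j) / Z)"
  using divide_right_mono[OF log_sobolev[OF weak_dep_axioms, of u], of Z] Z_pos
  by (simp add: lsi_const_def)

lemma sum_energy: "(\<Sum>j\<in>V. energy V w u j) / Z = 2 * mean (\<lambda>\<sigma>. (grad V u \<sigma>)\<^sup>2)"
  unfolding energy_def mean_def grad_square
  by (subst sum.swap) (simp add: sum_distrib_left[symmetric] sum_divide_distrib[symmetric])

text \<open>Variance and gradient do not see an additive constant, so \<open>f\<close> may be
  shifted to a positive \<open>u\<close>. Then \<open>ln x \<le> x - 1\<close> bounds the variance
  by the left side of \<open>ent_lower\<close>.\<close>

lemma poincare:
  "mean (\<lambda>\<sigma>. (f \<sigma> - mean f)\<^sup>2) \<le> 2 * CL * mean (\<lambda>\<sigma>. (grad V f \<sigma>)\<^sup>2)"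
proof -
  \<comment> \<open>This shift makes the minimum of \<open>u\<close> equal to 1.\<close>
  define c where "c = 1 - Min (f ` spins V)"
  define u where "u \<sigma> = f \<sigma> + c" for \<sigma>
  have u1: "1 \<le> u \<sigma>" if "\<sigma> \<in> spins V" for \<sigma>
    using that by (simp add: u_def c_def finite_spins fin)
  have a: "1 \<le> mean u" using mean_mono[of "\<lambda>_. 1" u] u1 by simp
  have "1 \<le> (mean u)\<^sup>2" using power_mono[OF a, of 2] by simp
  with mean_square_le[of u] have b: "1 \<le> mean (\<lambda>\<sigma>. (u \<sigma>)\<^sup>2)" by linarith
  let ?a = "mean u" and ?b = "mean (\<lambda>\<sigma>. (u \<sigma>)\<^sup>2)"
  have "mean (\<lambda>\<sigma>. (f \<sigma> - mean f)\<^sup>2) = mean (\<lambda>\<sigma>. (u \<sigma> - mean u)\<^sup>2)"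
    by (simp add: u_def[abs_def] mean_add)
  also have "\<dots> = ?b - ?a\<^sup>2" by (rule variance_eq)
  also have "\<dots> = - (?b * (?a\<^sup>2 / ?b - 1))" using b by (simp add: algebra_simps)
  also have "\<dots> \<le> - (?b * ln (?a\<^sup>2 / ?b))"
    using a b by (intro le_imp_neg_le mult_left_mono ln_le_minus_one) auto
  also have "\<dots> = ?b * ln (?b / ?a\<^sup>2)" using a b by (simp add: ln_div right_diff_distrib)
  also have "\<dots> \<le> ent V w (\<lambda>\<sigma>. (u \<sigma>)\<^sup>2) / Z"
    using u1 a b by (intro ent_lower) (auto intro: order_trans[OF zero_le_one])
  also have "\<dots> \<le> 2 * CL * mean (\<lambda>\<sigma>. (grad V u \<sigma>)\<^sup>2)"
    using ent_upper[of u] by (simp add: sum_energy)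
  finally show ?thesis by (simp add: u_def grad_def)
qed

text \<open>The two ends of a flip contribute symmetric terms; moving the term at the flipped end
  back to \<open>\<sigma>\<close> costs the factor \<open>R\<close>.\<close>

lemma energy_power:
  assumes g: "\<And>\<sigma>. \<sigma> \<in> spins V \<Longrightarrow> 0 \<le> g \<sigma>" and m: "1 \<le> m"
  shows "(\<Sum>j\<in>V. energy V w (\<lambda>\<sigma>. g \<sigma> ^ m) j) / Z
    \<le> 2 * (real m)\<^sup>2 * (1 + R) * mean (\<lambda>\<sigma>. g \<sigma> ^ (2 * m - 2) * (grad V g \<sigma>)\<^sup>2)"
proof -
  let ?G = "\<lambda>j \<sigma>. (g \<sigma> - g (flip j \<sigma>))\<^sup>2 * g \<sigma> ^ (2 * m - 2)"
  have en: "energy V w (\<lambda>\<sigma>. g \<sigma> ^ m) j \<le> (real m)\<^sup>2 * (1 + R) * (\<Sum>\<sigma>\<in>spins V. w \<sigma> * ?G j \<sigma>)"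
    if j: "j \<in> V" for j
  proof -
    have "energy V w (\<lambda>\<sigma>. g \<sigma> ^ m) j
        \<le> (\<Sum>\<sigma>\<in>spins V. w \<sigma> * ((real m)\<^sup>2 * (?G j \<sigma> + ?G j (flip j \<sigma>))))"
      unfolding energy_def
    proof (intro sum_mono mult_left_mono)
      fix \<sigma> assume \<sigma>: "\<sigma> \<in> spins V"
      show "(g \<sigma> ^ m - g (flip j \<sigma>) ^ m)\<^sup>2 \<le> (real m)\<^sup>2 * (?G j \<sigma> + ?G j (flip j \<sigma>))"
        using power_diff_square_le[OF g[OF \<sigma>] g m, of "flip j \<sigma>"] \<sigma>
        by (simp add: power2_commute[of "g (flip j \<sigma>)"] algebra_simps)
      show "0 \<le> w \<sigma>" using w_pos[OF \<sigma>] by simp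
    qed
    also have "\<dots> = (real m)\<^sup>2 * ((\<Sum>\<sigma>\<in>spins V. w \<sigma> * ?G j \<sigma>) + (\<Sum>\<sigma>\<in>spins V. w \<sigma> * ?G j (flip j \<sigma>)))"
      unfolding sum.distrib[symmetric] sum_distrib_left
      by (intro sum.cong refl) (simp only: distrib_left mult.left_commute)
    also have "\<dots> \<le> (real m)\<^sup>2 * ((\<Sum>\<sigma>\<in>spins V. w \<sigma> * ?G j \<sigma>) + R * (\<Sum>\<sigma>\<in>spins V. w \<sigma> * ?G j \<sigma>))"
      using sum_flip_le[OF j, of "?G j"] g by (intro mult_left_mono add_left_mono) auto
    finally show ?thesis by (simp only: distrib_right mult_1 mult.assoc)
  qed
  have "(\<Sum>j\<in>V. energy V w (\<lambda>\<sigma>. g \<sigma> ^ m) j)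
      \<le> (\<Sum>j\<in>V. (real m)\<^sup>2 * (1 + R) * (\<Sum>\<sigma>\<in>spins V. w \<sigma> * ?G j \<sigma>))"
    by (intro sum_mono en)
  also have "\<dots> = (real m)\<^sup>2 * (1 + R) * (\<Sum>\<sigma>\<in>spins V. \<Sum>j\<in>V. w \<sigma> * ?G j \<sigma>)"
    by (subst sum.swap) (simp only: sum_distrib_left)
  also have "(\<Sum>\<sigma>\<in>spins V. \<Sum>j\<in>V. w \<sigma> * ?G j \<sigma>)
      = 2 * (\<Sum>\<sigma>\<in>spins V. w \<sigma> * (g \<sigma> ^ (2 * m - 2) * (grad V g \<sigma>)\<^sup>2))"
    unfolding sum_distrib_left
    by (intro sum.cong refl) (simp add: grad_square sum_distrib_left sum_distrib_right mult_ac)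
  finally show ?thesis using Z_pos by (simp add: mean_def divide_right_mono less_imp_le mult_ac)
qed

text \<open>The step \<open>p/2 \<rightarrow> p\<close> keeps the sharp linear growth in \<open>p\<close>: the log-Sobolev inequality for
  \<open>g\<^sup>p\<^sup>/\<^sup>2\<close> bounds \<open>p ln (\<parallel>g\<parallel>\<^sub>p / \<parallel>g\<parallel>\<^sub>p\<^sub>/\<^sub>2)\<close>.\<close>

lemma moment_double:
  assumes g: "\<And>\<sigma>. \<sigma> \<in> spins V \<Longrightarrow> 0 \<le> g \<sigma>" and m: "1 \<le> m" and y: "0 \<le> y" and b: "0 < b"
    and R: "0 \<le> R"
    and low: "mean (\<lambda>\<sigma>. g \<sigma> ^ m) \<le> y ^ m"
    and gr: "mean (\<lambda>\<sigma>. grad V g \<sigma> ^ (2 * m)) \<le> b ^ (2 * m)"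
  shows "mean (\<lambda>\<sigma>. g \<sigma> ^ (2 * m)) \<le> sqrt (y\<^sup>2 + K * real m * b\<^sup>2) ^ (2 * m)"
proof -
  let ?p = "2 * m"
  define M where "M = mean (\<lambda>\<sigma>. g \<sigma> ^ ?p)"
  \<comment> \<open>The norm of \<open>g\<close> of order \<open>?p\<close>, for which the claim
    reads \<open>A \<le> sqrt (y\<^sup>2 + K * real m * b\<^sup>2)\<close>.\<close>
  define A where "A = root ?p M"
  have CL: "0 \<le> CL" using R by (simp add: lsi_const_def)
  then have K: "0 \<le> K" using R by (simp add: moment_const_def)
  have M0: "0 \<le> M" unfolding M_def using g by (intro mean_nonneg) auto
  show ?thesis
  proof (cases "M = 0")
    case True
    then show ?thesis using K by (simp add: M_def)
  next
    case False
    then have M: "0 < M" using M0 by simp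
    have A: "0 < A" "A ^ ?p = M" using M m by (auto simp: A_def)
    have p: "t ^ ?p = t ^ (?p - 2) * t\<^sup>2" for t :: real
      using m by (intro power_split_square) simp
    let ?u = "\<lambda>\<sigma>. g \<sigma> ^ m" and ?a = "mean (\<lambda>\<sigma>. g \<sigma> ^ m)"
    have u2: "mean (\<lambda>\<sigma>. (?u \<sigma>)\<^sup>2) = M" by (simp add: M_def power_mult[symmetric] mult.commute)
    have a: "0 < ?a"
    proof (rule ccontr)
      assume "\<not> 0 < ?a"
      moreover have "0 \<le> ?a" using g by (intro mean_nonneg) auto
      ultimately have "(\<Sum>\<sigma>\<in>spins V. w \<sigma> * ?u \<sigma>) = 0" using Z_pos by (simp add: mean_def)
      then have "\<forall>\<sigma>\<in>spins V. w \<sigma> * ?u \<sigma> = 0"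
        using g w_pos by (subst sum_nonneg_eq_0_iff[symmetric]) (auto simp: finite_spins fin less_imp_le)
      then have "\<forall>\<sigma>\<in>spins V. g \<sigma> = 0" using w_pos m by force
      then have "M = mean (\<lambda>_. 0)" unfolding M_def using m by (intro mean_cong) auto
      then show False using M by simp
    qed
    have y0: "0 < y" using a low y m by (cases "y = 0") (auto simp: power_0_left)
    have "mean (\<lambda>\<sigma>. g \<sigma> ^ (?p - 2) * (grad V g \<sigma>)\<^sup>2)
        \<le> mean (\<lambda>\<sigma>. A ^ (?p - 2) * b\<^sup>2 * (inverse M * g \<sigma> ^ ?p + inverse (b ^ ?p) * grad V g \<sigma> ^ ?p))"
    proof (rule mean_mono)
      fix \<sigma> assume \<sigma>: "\<sigma> \<in> spins V"
      \<comment> \<open>After scaling \<open>g\<close> by \<open>A\<close> and the gradient by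
        \<open>b\<close>, both moments of order \<open>?p\<close> are at most 1, so Young's
        inequality costs only a factor 2.\<close>
      have "(g \<sigma> / A) ^ (?p - 2) * (grad V g \<sigma> / b)\<^sup>2 \<le> (g \<sigma> / A) ^ ?p + (grad V g \<sigma> / b) ^ ?p"
        using g[OF \<sigma>] A b m grad_nonneg[of V g \<sigma>] by (intro young_power) auto
      then have le: "A ^ (?p - 2) * b\<^sup>2 * ((g \<sigma> / A) ^ (?p - 2) * (grad V g \<sigma> / b)\<^sup>2)
          \<le> A ^ (?p - 2) * b\<^sup>2 * ((g \<sigma> / A) ^ ?p + (grad V g \<sigma> / b) ^ ?p)"
        using A by (intro mult_left_mono) auto
      show "g \<sigma> ^ (?p - 2) * (grad V g \<sigma>)\<^sup>2
          \<le> A ^ (?p - 2) * b\<^sup>2 * (inverse M * g \<sigma> ^ ?p + inverse (b ^ ?p) * grad V g \<sigma> ^ ?p)"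
      proof -
        have "A ^ (?p - 2) * b\<^sup>2 * ((g \<sigma> / A) ^ (?p - 2) * (grad V g \<sigma> / b)\<^sup>2)
            = g \<sigma> ^ (?p - 2) * (grad V g \<sigma>)\<^sup>2"
          using A(1) b by (simp add: power_divide)
        moreover have "(g \<sigma> / A) ^ ?p = inverse M * g \<sigma> ^ ?p"
          by (simp only: power_divide A(2)) (simp add: divide_inverse)
        moreover have "(grad V g \<sigma> / b) ^ ?p = inverse (b ^ ?p) * grad V g \<sigma> ^ ?p"
          by (simp only: power_divide) (simp add: divide_inverse)
        ultimately show ?thesis using le by (simp only:)
      qed
    qed
    also have "\<dots> = A ^ (?p - 2) * b\<^sup>2 * (inverse M * M + inverse (b ^ ?p) * mean (\<lambda>\<sigma>. grad V g \<sigma> ^ ?p))"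
      by (simp only: mean_cmult mean_add M_def)
    also have "\<dots> \<le> A ^ (?p - 2) * b\<^sup>2 * (1 + 1)"
    proof -
      have "inverse (b ^ ?p) * mean (\<lambda>\<sigma>. grad V g \<sigma> ^ ?p) \<le> 1"
        using gr b by (simp add: divide_inverse[symmetric] mult.commute[of "inverse _"])
      then show ?thesis using A M by (intro mult_left_mono add_mono) auto
    qed
    finally have young: "mean (\<lambda>\<sigma>. g \<sigma> ^ (?p - 2) * (grad V g \<sigma>)\<^sup>2) \<le> 2 * A ^ (?p - 2) * b\<^sup>2" by simp
    have "M * (real m * (1 - y\<^sup>2 / A\<^sup>2)) \<le> M * ln (M / ?a\<^sup>2)"
    proof (rule mult_left_mono)
      \<comment> \<open>This form of the logarithm bound turns the estimate into one that is linear
        in \<open>A\<^sup>2 - y\<^sup>2\<close>.\<close>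
      have "1 - y\<^sup>2 / A\<^sup>2 \<le> - ln (y\<^sup>2 / A\<^sup>2)"
        using ln_le_minus_one[of "y\<^sup>2 / A\<^sup>2"] y0 A by simp
      also have "\<dots> = ln (A\<^sup>2 / y\<^sup>2)" using y0 A by (simp add: ln_div)
      finally have "real m * (1 - y\<^sup>2 / A\<^sup>2) \<le> real m * ln (A\<^sup>2 / y\<^sup>2)"
        by (intro mult_left_mono) auto
      also have "\<dots> = ln ((A\<^sup>2 / y\<^sup>2) ^ m)" using y0 A by (simp add: ln_realpow)
      also have "(A\<^sup>2 / y\<^sup>2) ^ m = M / (y ^ m)\<^sup>2"
        by (simp add: power_divide power_mult[symmetric] A(2)[symmetric] mult.commute)
      also have "ln \<dots> \<le> ln (M / ?a\<^sup>2)"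
        using a low M y0 by (simp add: frac_le power_mono)
      finally show "real m * (1 - y\<^sup>2 / A\<^sup>2) \<le> ln (M / ?a\<^sup>2)" .
    qed (rule M0)
    also have "\<dots> \<le> ent V w (\<lambda>\<sigma>. (?u \<sigma>)\<^sup>2) / Z"
      using ent_lower[of ?u] g a M unfolding u2 by simp
    also have "\<dots> \<le> CL * (2 * (real m)\<^sup>2 * (1 + R) * (2 * A ^ (?p - 2) * b\<^sup>2))"
    proof -
      have "(\<Sum>j\<in>V. energy V w ?u j) / Z \<le> 2 * (real m)\<^sup>2 * (1 + R) * (2 * A ^ (?p - 2) * b\<^sup>2)"
        by (rule order_trans[OF energy_power[OF g m] mult_left_mono[OF young]]) (use R in auto)
      then show ?thesis by (intro order_trans[OF ent_upper] mult_left_mono CL)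
    qed
    also have "\<dots> = A ^ (?p - 2) * (real m * (K * real m * b\<^sup>2))"
      by (simp add: moment_const_def power2_eq_square)
    also have "M * (real m * (1 - y\<^sup>2 / A\<^sup>2)) = A ^ (?p - 2) * (real m * (A\<^sup>2 - y\<^sup>2))"
      unfolding A(2)[symmetric] p[of A] using A by (simp add: right_diff_distrib)
    finally have "A ^ (?p - 2) * (real m * (A\<^sup>2 - y\<^sup>2)) \<le> A ^ (?p - 2) * (real m * (K * real m * b\<^sup>2))" .
    then have "A\<^sup>2 - y\<^sup>2 \<le> K * real m * b\<^sup>2" using A m by simp
    then have "A \<le> sqrt (y\<^sup>2 + K * real m * b\<^sup>2)" by (intro real_le_rsqrt) simp
    then show ?thesis using A by (simp add: M_def[symmetric] A(2)[symmetric] power_mono)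
  qed
qed

text \<open>Starting from the first moment, each doubling from \<open>2 ^ j\<close> adds
  \<open>K * 2 ^ j * b\<^sup>2\<close> to the squared norm. The geometric sum
  \<open>2 ^ k - 1\<close> keeps the growth linear in the final exponent.\<close>

lemma moment_bound:
  assumes g: "\<And>\<sigma>. \<sigma> \<in> spins V \<Longrightarrow> 0 \<le> g \<sigma>" and a: "0 \<le> a" "mean g \<le> a" and b: "0 < b"
    and R: "0 \<le> R"
    and gr: "mean (\<lambda>\<sigma>. grad V g \<sigma> ^ (2 ^ k)) \<le> b ^ (2 ^ k)"
  shows "mean (\<lambda>\<sigma>. g \<sigma> ^ (2 ^ k)) \<le> (a + sqrt (K * 2 ^ k) * b) ^ (2 ^ k)"
proof -
  have K: "0 \<le> K" using R by (simp add: moment_const_def lsi_const_def)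
  have "mean (\<lambda>\<sigma>. g \<sigma> ^ (2 ^ j)) \<le> sqrt (a\<^sup>2 + K * (2 ^ j - 1) * b\<^sup>2) ^ (2 ^ j)" if "j \<le> k" for j
    using that
  proof (induction j)
    case 0
    then show ?case using a by simp
  next
    case (Suc j)
    let ?y = "sqrt (a\<^sup>2 + K * (2 ^ j - 1) * b\<^sup>2)"
    have y: "0 \<le> a\<^sup>2 + K * (2 ^ j - 1) * b\<^sup>2" using K by simp
    have "mean (\<lambda>\<sigma>. grad V g \<sigma> ^ (2 ^ Suc j)) \<le> b ^ (2 ^ Suc j)"
      using Suc.prems b gr by (intro moment_antimono[of b "Suc j" k]) (auto simp: grad_nonneg)
    then have "mean (\<lambda>\<sigma>. g \<sigma> ^ (2 * 2 ^ j)) \<le> sqrt (?y\<^sup>2 + K * real (2 ^ j) * b\<^sup>2) ^ (2 * 2 ^ j)"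
      using Suc g b R y by (intro moment_double) auto
    also have "?y\<^sup>2 + K * real (2 ^ j) * b\<^sup>2 = a\<^sup>2 + K * (2 ^ Suc j - 1) * b\<^sup>2"
      using y by (simp add: algebra_simps)
    finally show ?case by simp
  qed
  then have "mean (\<lambda>\<sigma>. g \<sigma> ^ (2 ^ k)) \<le> sqrt (a\<^sup>2 + K * (2 ^ k - 1) * b\<^sup>2) ^ (2 ^ k)" by simp
  also have "\<dots> \<le> (a + sqrt (K * 2 ^ k) * b) ^ (2 ^ k)"
  proof (rule power_mono)
    have "a\<^sup>2 + K * (2 ^ k - 1) * b\<^sup>2 \<le> a\<^sup>2 + K * 2 ^ k * b\<^sup>2"
      using K by (intro add_left_mono mult_right_mono mult_left_mono) auto
    \<comment> \<open>Only the nonnegative cross term is added.\<close>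
    also have "\<dots> \<le> (a + sqrt (K * 2 ^ k) * b)\<^sup>2"
      using K a b by (simp add: power2_sum power_mult_distrib)
    finally show "sqrt (a\<^sup>2 + K * (2 ^ k - 1) * b\<^sup>2) \<le> a + sqrt (K * 2 ^ k) * b"
      using K a b by (intro real_le_lsqrt) auto
  qed (use K in simp)
  finally show ?thesis .
qed

end

section \<open>Iterated differences and exponential moments\<close>

lemma L2_set_diff_le: "\<bar>L2_set f S - L2_set g S\<bar> \<le> L2_set (\<lambda>i. f i - g i) S"
proof -
  have "L2_set f S \<le> L2_set (\<lambda>i. f i - g i) S + L2_set g S"
    using L2_set_triangle_ineq[of "\<lambda>i. f i - g i" g S] by simp
  moreover have "L2_set g S \<le> L2_set (\<lambda>i. g i - f i) S + L2_set f S"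
    using L2_set_triangle_ineq[of "\<lambda>i. g i - f i" f S] by simp
  moreover have "L2_set (\<lambda>i. g i - f i) S = L2_set (\<lambda>i. f i - g i) S"
    by (simp add: L2_set_def power2_commute)
  ultimately show ?thesis by linarith
qed

text \<open>The head of the index list is the outermost difference in \<open>hiter\<close>, so this
  splits off the direction of the last difference taken.\<close>

lemma sum_lists_Suc:
  "(\<Sum>is | length is = Suc d \<and> set is \<subseteq> {..<n}. F is)
    = (\<Sum>i<n. \<Sum>is | length is = d \<and> set is \<subseteq> {..<n}. F (i # is))"
proof -
  have "(\<Sum>is | length is = Suc d \<and> set is \<subseteq> {..<n}. F is)
    = (\<Sum>(i, is)\<in>{..<n} \<times> {is. length is = d \<and> set is \<subseteq> {..<n}}. F (i # is))"
    by (rule sum.reindex_bij_witness[of _ "\<lambda>(i, is). i # is" "\<lambda>is. (hd is, tl is)"])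
      (auto simp: length_Suc_conv)
  then show ?thesis by (simp add: sum.cartesian_product)
qed

lemma htensor_norm_nonneg: "0 \<le> htensor_norm n d f \<sigma>"
  by (simp add: htensor_norm_def sum_nonneg)

lemma htensor_norm_1: "htensor_norm n (Suc 0) f \<sigma> = grad {..<n} f \<sigma>"
proof -
  have "{is :: nat list. length is = 0 \<and> set is \<subseteq> {..<n}} = {[]}" by auto
  then show ?thesis
    by (simp add: htensor_norm_def sum_lists_Suc grad_def hdiff_def power_divide)
qed

text \<open>The reverse triangle inequality, applied in each direction.\<close>

lemma grad_htensor_norm:
  "grad {..<n} (htensor_norm n d f) \<sigma> \<le> htensor_norm n (Suc d) f \<sigma>"
proof -
  let ?L = "{is. length is = d \<and> set is \<subseteq> {..<n}}"
  have "(htensor_norm n d f \<sigma> - htensor_norm n d f (flip j \<sigma>))\<^sup>2 / 2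
      \<le> (\<Sum>is\<in>?L. (hiter (j # is) f \<sigma>)\<^sup>2)" for j
  proof -
    have "\<bar>htensor_norm n d f \<sigma> - htensor_norm n d f (flip j \<sigma>)\<bar>
        \<le> L2_set (\<lambda>is. hiter is f \<sigma> - hiter is f (flip j \<sigma>)) ?L"
      using L2_set_diff_le by (simp add: htensor_norm_def L2_set_def)
    then have "\<bar>htensor_norm n d f \<sigma> - htensor_norm n d f (flip j \<sigma>)\<bar>\<^sup>2
        \<le> (L2_set (\<lambda>is. hiter is f \<sigma> - hiter is f (flip j \<sigma>)) ?L)\<^sup>2"
      by (intro power_mono) auto
    then show ?thesis
      by (simp add: L2_set_def sum_nonneg hdiff_def power_divide flip: sum_divide_distrib)
  qed
  then show ?thesis
    unfolding grad_def htensor_norm_def[of n "Suc d"] sum_lists_Suc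
    by (intro real_sqrt_le_mono sum_mono)
qed

text \<open>Moment bounds are available only at powers of two; rounding an exponent up costs at most
  a factor 2.\<close>

lemma exists_power_two: "1 \<le> m \<Longrightarrow> \<exists>k. m \<le> 2 ^ k \<and> 2 ^ k \<le> 2 * m" for m :: nat
proof (induction m rule: dec_induct)
  case base
  show ?case by (intro exI[of _ 0]) simp
next
  case (step m)
  then obtain k where k: "m \<le> 2 ^ k" "2 ^ k \<le> 2 * m" by blast
  show ?case
  proof (cases "Suc m \<le> 2 ^ k")
    case True
    then show ?thesis using k by (intro exI[of _ k]) simp
  next
    case False
    then have "m = 2 ^ k" using k by simp
    then show ?thesis by (intro exI[of _ "Suc k"]) simp
  qed
qed

text \<open>The term of index \<open>m\<close> in the exponential series at \<open>m\<close> is at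
  most the whole sum.\<close>

lemma power_self_le_exp_fact: "real m ^ m \<le> exp (real m) * fact m"
proof -
  have "(\<Sum>n\<in>{m}. real m ^ n /\<^sub>R fact n) \<le> (\<Sum>n. real m ^ n /\<^sub>R fact n)"
    by (intro sum_le_suminf summable_exp_generic) auto
  then show ?thesis by (simp add: exp_def field_simps)
qed

section \<open>From the difference tensors to exponential integrability\<close>

context weak_dep
begin

lemma moment_const_ge:
  assumes "0 \<le> R"
  shows "1 \<le> K" "0 \<le> CL" "2 * CL \<le> K"
proof -
  have "\<alpha>\<^sup>2 \<le> 1" using \<alpha> by (simp add: power_le_one)
  moreover have "1 \<le> (1 + R) ^ 3" using assms by (intro one_le_power) simp
  ultimately have "\<alpha>\<^sup>2 \<le> 2 * (1 + R) ^ 3" by simp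
  then have CL: "1 \<le> CL" using \<alpha> by (simp add: lsi_const_def)
  then have "CL * 1 \<le> CL * (1 + R)" using assms by (intro mult_left_mono) auto
  then have "4 * CL \<le> K" by (simp add: moment_const_def)
  then show "1 \<le> K" "0 \<le> CL" "2 * CL \<le> K" using CL by auto
qed

text \<open>Descend from order \<open>d\<close>, where the supremum bound controls all moments. At
  each lower order, the gradient is dominated by the order just treated and the first moment by the
  \<open>L2\<close> hypothesis, so \<open>moment_bound\<close> costs one more factor
  \<open>sqrt (K * 2 ^ k)\<close>. Order 0 is excluded, since there the tensor norm is the absolute
  value of \<open>f\<close> itself.\<close>

lemma htensor_moment:
  assumes V: "V = {..<n}" and R: "0 \<le> R"
    and norm2: "\<And>k. k \<in> {1..<d} \<Longrightarrow> mean (\<lambda>\<sigma>. (htensor_norm n k f \<sigma>)\<^sup>2) \<le> 1"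
    and sup: "\<And>\<sigma>. \<sigma> \<in> spins V \<Longrightarrow> htensor_norm n d f \<sigma> \<le> 1"
    and e: "e < d"
  shows "mean (\<lambda>\<sigma>. htensor_norm n (d - e) f \<sigma> ^ (2 ^ k)) \<le> ((real e + 1) * sqrt (K * 2 ^ k) ^ e) ^ (2 ^ k)"
  using e
proof (induction e)
  case 0
  show ?case using sup by (auto intro!: mean_le_const power_le_one htensor_norm_nonneg)
next
  case (Suc e)
  let ?B = "sqrt (K * 2 ^ k)" and ?G = "htensor_norm n (d - Suc e) f"
  have "1 * 1 \<le> K * 2 ^ k" using moment_const_ge(1)[OF R] by (intro mult_mono) auto
  then have B: "1 \<le> ?B" by simp
  have "grad V ?G \<sigma> \<le> htensor_norm n (d - e) f \<sigma>" for \<sigma>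
    using grad_htensor_norm[of n "d - Suc e" f \<sigma>] Suc.prems by (simp add: V Suc_diff_Suc)
  then have "mean (\<lambda>\<sigma>. grad V ?G \<sigma> ^ (2 ^ k)) \<le> mean (\<lambda>\<sigma>. htensor_norm n (d - e) f \<sigma> ^ (2 ^ k))"
    by (intro mean_mono power_mono grad_nonneg)
  also have "\<dots> \<le> ((real e + 1) * ?B ^ e) ^ (2 ^ k)" using Suc by simp
  finally have gr: "mean (\<lambda>\<sigma>. grad V ?G \<sigma> ^ (2 ^ k)) \<le> ((real e + 1) * ?B ^ e) ^ (2 ^ k)" .
  have "d - Suc e \<in> {1..<d}" using Suc.prems by auto
  from norm2[OF this] have "(mean ?G)\<^sup>2 \<le> 1\<^sup>2"
    using mean_square_le[of ?G] by simp
  then have "mean ?G \<le> 1" by (rule power2_le_imp_le) simp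
  then have "mean (\<lambda>\<sigma>. ?G \<sigma> ^ (2 ^ k)) \<le> (1 + ?B * ((real e + 1) * ?B ^ e)) ^ (2 ^ k)"
    using B by (intro moment_bound gr R htensor_norm_nonneg mult_pos_pos) auto
  also have "\<dots> \<le> ((real (Suc e) + 1) * ?B ^ Suc e) ^ (2 ^ k)"
  proof (rule power_mono)
    \<comment> \<open>As \<open>?B\<close> is at least 1, the first moment is absorbed by raising
      the prefactor by one.\<close>
    have "1 \<le> ?B ^ Suc e" using B by (rule one_le_power)
    then show "1 + ?B * ((real e + 1) * ?B ^ e) \<le> (real (Suc e) + 1) * ?B ^ Suc e"
      by (simp add: algebra_simps)
    show "0 \<le> 1 + ?B * ((real e + 1) * ?B ^ e)" using B by simp
  qed
  finally show ?case .
qed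

text \<open>The last descent, from order one to the centred function. The first moment is now
  bounded by the Poincare inequality.\<close>

lemma centered_moment:
  assumes V: "V = {..<n}" and R: "0 \<le> R" and d: "1 \<le> d"
    and norm2: "\<And>k. k \<in> {1..<d} \<Longrightarrow> mean (\<lambda>\<sigma>. (htensor_norm n k f \<sigma>)\<^sup>2) \<le> 1"
    and sup: "\<And>\<sigma>. \<sigma> \<in> spins V \<Longrightarrow> htensor_norm n d f \<sigma> \<le> 1"
  shows "mean (\<lambda>\<sigma>. \<bar>f \<sigma> - mean f\<bar> ^ (2 ^ k)) \<le> ((real d + 1) * sqrt (K * 2 ^ k) ^ d) ^ (2 ^ k)"
proof -
  let ?B = "sqrt (K * 2 ^ k)" and ?X = "\<lambda>\<sigma>. \<bar>f \<sigma> - mean f\<bar>"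
  note K = moment_const_ge[OF R]
  have "1 * 1 \<le> K * 2 ^ k" using K by (intro mult_mono) auto
  then have B: "1 \<le> ?B" by simp
  have h1: "htensor_norm n 1 f = grad V f" using htensor_norm_1 by (auto simp: V)
  have "grad V ?X \<sigma> \<le> grad V f \<sigma>" for \<sigma>
    unfolding grad_def
    by (intro real_sqrt_le_mono sum_mono divide_right_mono) (auto intro!: abs_le_square_iff[THEN iffD1])
  then have "mean (\<lambda>\<sigma>. grad V ?X \<sigma> ^ (2 ^ k)) \<le> mean (\<lambda>\<sigma>. htensor_norm n (d - (d - 1)) f \<sigma> ^ (2 ^ k))"
    using d h1 by (intro mean_mono power_mono) (auto simp: grad_nonneg)
  also have "\<dots> \<le> ((real (d - 1) + 1) * ?B ^ (d - 1)) ^ (2 ^ k)"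
    using d by (intro htensor_moment V R norm2 sup) auto
  also have "real (d - 1) + 1 = real d" using d by simp
  finally have gr: "mean (\<lambda>\<sigma>. grad V ?X \<sigma> ^ (2 ^ k)) \<le> (real d * ?B ^ (d - 1)) ^ (2 ^ k)" .
  have "mean (\<lambda>\<sigma>. (grad V f \<sigma>)\<^sup>2) \<le> 1"
  \<comment> \<open>For \<open>d = 1\<close> the range of the \<open>L2\<close> hypotheses is empty
    and the supremum bound takes their place.\<close>
  proof (cases "d = 1")
    case True
    then have "grad V f \<sigma> \<le> 1" if "\<sigma> \<in> spins V" for \<sigma> using sup[OF that] h1 by simp
    then show ?thesis by (intro mean_le_const power_le_one grad_nonneg) auto
  next
    case False
    then show ?thesis using norm2[of 1] d h1 by simp
  qed
  then have "2 * CL * mean (\<lambda>\<sigma>. (grad V f \<sigma>)\<^sup>2) \<le> 2 * CL * 1"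
    using K by (intro mult_left_mono) auto
  moreover have "(mean ?X)\<^sup>2 \<le> mean (\<lambda>\<sigma>. (f \<sigma> - mean f)\<^sup>2)" using mean_square_le[of ?X] by simp
  moreover have "K * 1 \<le> K * 2 ^ k" using K by (intro mult_left_mono) auto
  ultimately have "(mean ?X)\<^sup>2 \<le> K * 2 ^ k" using poincare[of f] K by linarith
  then have "mean ?X \<le> ?B" by (rule real_le_rsqrt)
  then have "mean (\<lambda>\<sigma>. ?X \<sigma> ^ (2 ^ k)) \<le> (?B + ?B * (real d * ?B ^ (d - 1))) ^ (2 ^ k)"
    using B d by (intro moment_bound gr R mult_pos_pos) auto
  also have "\<dots> \<le> ((real d + 1) * ?B ^ d) ^ (2 ^ k)"
  proof (rule power_mono)
    have "?B ^ d = ?B * ?B ^ (d - 1)" using d by (cases d) auto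
    moreover have "?B \<le> ?B ^ d" using B d by (intro self_le_power) auto
    ultimately show "?B + ?B * (real d * ?B ^ (d - 1)) \<le> (real d + 1) * ?B ^ d"
      by (simp add: algebra_simps)
    show "0 \<le> ?B + ?B * (real d * ?B ^ (d - 1))" using B by simp
  qed
  finally show ?thesis .
qed

text \<open>Below the threshold \<open>S\<close>, a bound for the norm of \<open>X\<close> of order
  \<open>P\<close>, use \<open>S powr (2 / real d) \<le> T\<close>. Above it, \<open>X / S\<close>
  is at least 1 and its exponent \<open>2 * m / d\<close> may be raised to \<open>P\<close>. Each
  region contributes at most \<open>T ^ m\<close>.\<close>

lemma fractional_moment:
  assumes X: "\<And>\<sigma>. \<sigma> \<in> spins V \<Longrightarrow> 0 \<le> X \<sigma>" and D: "1 \<le> D" and d: "1 \<le> d" and K: "1 \<le> K"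
    and mom: "\<And>k. mean (\<lambda>\<sigma>. X \<sigma> ^ (2 ^ k)) \<le> (D * sqrt (K * 2 ^ k) ^ d) ^ (2 ^ k)"
    and m: "1 \<le> m"
  shows "mean (\<lambda>\<sigma>. (X \<sigma> powr (2 / real d)) ^ m) \<le> 2 * (4 * K * D\<^sup>2 * real m) ^ m"
proof -
  obtain k0 where k0: "m \<le> 2 ^ k0" "2 ^ k0 \<le> 2 * m" using exists_power_two[OF m] by blast
  define k where "k = Suc k0"
  define P :: nat where "P = 2 ^ k"
  \<comment> \<open>The lower bound makes \<open>P\<close> exceed \<open>2 * m / d\<close>; the
    upper bound is the source of the 4 in the claim.\<close>
  have P: "2 * m \<le> P" "P \<le> 4 * m" using k0 by (auto simp: P_def k_def)
  define B where "B = sqrt (K * real P)"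
  define S where "S = D * B ^ d"
  define T where "T = D\<^sup>2 * (K * real P)"
  have KP: "1 \<le> K * real P" using mult_mono[of 1 K 1 "real P"] K P m by simp
  then have B: "1 \<le> B" by (simp add: B_def)
  have S: "0 < S" using D B by (simp add: S_def)
  have T: "0 < T" using D KP by (simp add: T_def)
  have mX: "mean (\<lambda>\<sigma>. X \<sigma> ^ P) \<le> S ^ P"
    using mom[of k] by (simp add: P_def S_def B_def)
  have ST: "S powr (2 / real d) \<le> T"
  proof -
    have "B ^ d = B powr real d" using B by (intro powr_realpow[symmetric]) simp
    then have "(B ^ d) powr (2 / real d) = B powr 2" using d by (simp only: powr_powr) simp
    also have "\<dots> = K * real P" using B KP by (simp add: B_def)
    finally have 1: "(B ^ d) powr (2 / real d) = K * real P" .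
    have "D powr (2 / real d) \<le> D powr 2"
      using D d by (intro powr_mono) (auto simp: divide_le_eq)
    then have "D powr (2 / real d) \<le> D\<^sup>2" using D by simp
    then show ?thesis using D B KP
      by (simp add: S_def T_def powr_mult 1 mult_right_mono)
  qed
  have pt: "(X \<sigma> powr (2 / real d)) ^ m \<le> T ^ m + T ^ m * inverse (S ^ P) * X \<sigma> ^ P"
    if \<sigma>: "\<sigma> \<in> spins V" for \<sigma>
  proof (cases "X \<sigma> \<le> S")
    case True
    then have "X \<sigma> powr (2 / real d) \<le> S powr (2 / real d)"
      using X[OF \<sigma>] by (intro powr_mono2) auto
    then have "X \<sigma> powr (2 / real d) \<le> T" using ST by simp
    then have "(X \<sigma> powr (2 / real d)) ^ m \<le> T ^ m" by (intro power_mono) auto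
    moreover have "0 \<le> T ^ m * inverse (S ^ P) * X \<sigma> ^ P" using T S X[OF \<sigma>] by simp
    ultimately show ?thesis by linarith
  next
    case False
    define z where "z = X \<sigma> / S"
    have z: "1 \<le> z" and Xz: "X \<sigma> = z * S" using False S by (auto simp: z_def)
    have "X \<sigma> powr (2 / real d) = z powr (2 / real d) * S powr (2 / real d)"
      using z S by (simp add: Xz powr_mult)
    also have "\<dots> \<le> z powr (2 / real d) * T" using ST by (intro mult_left_mono) auto
    finally have "(X \<sigma> powr (2 / real d)) ^ m \<le> (z powr (2 / real d) * T) ^ m"
      by (intro power_mono) auto
    also have "\<dots> = z powr (2 / real d * real m) * T ^ m"
    proof -
      have "(z powr (2 / real d)) ^ m = (z powr (2 / real d)) powr real m"
        using z by (intro powr_realpow[symmetric]) simp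
      then show ?thesis by (simp add: power_mult_distrib powr_powr)
    qed
    also have "z powr (2 / real d * real m) \<le> z powr real P"
    proof (rule powr_mono[OF _ z])
      have "2 / real d * real m \<le> 2 * real m" using d m by (simp add: divide_le_eq)
      then show "2 / real d * real m \<le> real P" using P by linarith
    qed
    also have "z powr real P = z ^ P" using z by (intro powr_realpow) simp
    also have "z ^ P = inverse (S ^ P) * X \<sigma> ^ P"
      by (simp only: z_def power_divide) (simp add: divide_inverse)
    finally have "(X \<sigma> powr (2 / real d)) ^ m \<le> T ^ m * inverse (S ^ P) * X \<sigma> ^ P"
      using T by (simp add: mult_ac)
    then show ?thesis using T by (simp add: add_increasing)
  qed
  have "mean (\<lambda>\<sigma>. (X \<sigma> powr (2 / real d)) ^ m)
      \<le> mean (\<lambda>\<sigma>. T ^ m + T ^ m * inverse (S ^ P) * X \<sigma> ^ P)"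
    by (intro mean_mono pt)
  also have "\<dots> = T ^ m + T ^ m * inverse (S ^ P) * mean (\<lambda>\<sigma>. X \<sigma> ^ P)"
    by (simp only: mean_add mean_cmult mean_const)
  also have "\<dots> \<le> T ^ m + T ^ m * inverse (S ^ P) * S ^ P"
    using T S by (intro add_left_mono mult_left_mono mX) auto
  also have "\<dots> = 2 * T ^ m" using S by simp
  also have "\<dots> \<le> 2 * (4 * K * D\<^sup>2 * real m) ^ m"
  proof (intro mult_left_mono power_mono)
    have "D\<^sup>2 * K * real P \<le> D\<^sup>2 * K * (4 * real m)"
      using P D K by (intro mult_left_mono) auto
    then show "T \<le> 4 * K * D\<^sup>2 * real m" by (simp add: T_def mult_ac)
  qed (use T in auto)
  finally show ?thesis .
qed

text \<open>Termwise in the exponential series: \<open>m ^ m\<close> over the factorial is at most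
  \<open>exp 1 ^ m\<close>, and the constant is chosen so that the term of index \<open>m\<close> is
  at most \<open>2 * (1 / 3) ^ m\<close>.\<close>

lemma exp_moment:
  assumes L: "0 < L" and Y: "\<And>m. 1 \<le> m \<Longrightarrow> mean (\<lambda>\<sigma>. Y \<sigma> ^ m) \<le> 2 * (L * real m) ^ m"
  shows "mean (\<lambda>\<sigma>. exp (1 / (3 * exp 1 * L) * Y \<sigma>)) \<le> 2"
proof -
  define c where "c = 1 / (3 * exp 1 * L)"
  have c: "0 < c" using L by (simp add: c_def)
  \<comment> \<open>The term of index 0 is exactly 1 and not 2. This correction brings the total of
    the series from 3 down to the required 2.\<close>
  let ?h = "\<lambda>m. 2 * (1 / 3 :: real) ^ m - (if m = 0 then 1 else 0)"
  have "(\<lambda>m. \<Sum>\<sigma>\<in>spins V. w \<sigma> * ((c * Y \<sigma>) ^ m /\<^sub>R fact m)) sums (\<Sum>\<sigma>\<in>spins V. w \<sigma> * exp (c * Y \<sigma>))"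
    by (intro sums_sum sums_mult exp_converges)
  then have exp_sums: "(\<lambda>m. mean (\<lambda>\<sigma>. (c * Y \<sigma>) ^ m /\<^sub>R fact m)) sums mean (\<lambda>\<sigma>. exp (c * Y \<sigma>))"
    unfolding mean_def by (rule sums_divide)
  have "(\<lambda>m. 2 * (1 / 3 :: real) ^ m) sums (2 * (1 / (1 - 1 / 3)))"
    by (intro sums_mult geometric_sums) simp
  moreover have "(\<lambda>m::nat. if m = 0 then 1 else 0 :: real) sums 1"
    using sums_single[of 0 "\<lambda>_. 1 :: real"] by simp
  ultimately have geometric: "?h sums (2 * (1 / (1 - 1 / 3)) - 1)"
    by (rule sums_diff)
  have le: "mean (\<lambda>\<sigma>. (c * Y \<sigma>) ^ m /\<^sub>R fact m) \<le> ?h m" for m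
  proof (cases "m = 0")
    case False
    have "mean (\<lambda>\<sigma>. (c * Y \<sigma>) ^ m /\<^sub>R fact m) = mean (\<lambda>\<sigma>. c ^ m / fact m * Y \<sigma> ^ m)"
      by (intro mean_cong) (simp add: power_mult_distrib divide_inverse)
    also have "\<dots> = c ^ m / fact m * mean (\<lambda>\<sigma>. Y \<sigma> ^ m)" by (rule mean_cmult)
    also have "\<dots> \<le> c ^ m / fact m * (2 * (L * real m) ^ m)"
      using c False by (intro mult_left_mono Y) auto
    also have "\<dots> = 2 * (c * L) ^ m * (real m ^ m / fact m)"
      by (simp add: power_mult_distrib)
    also have "\<dots> \<le> 2 * (c * L) ^ m * exp 1 ^ m"
    proof (rule mult_left_mono)
      show "real m ^ m / fact m \<le> exp 1 ^ m"
        using power_self_le_exp_fact[of m] exp_of_nat_mult[of m "1 :: real"] by (simp add: divide_le_eq)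
    qed (use c L in simp)
    also have "\<dots> = 2 * (c * L * exp 1) ^ m" by (simp add: power_mult_distrib)
    also have "c * L * exp 1 = 1 / 3" using L by (simp add: c_def)
    finally show ?thesis using False by simp
  qed simp
  have "mean (\<lambda>\<sigma>. exp (c * Y \<sigma>)) \<le> 2 * (1 / (1 - 1 / 3)) - 1"
    by (rule sums_le[OF le exp_sums geometric])
  then show ?thesis by (simp add: c_def)
qed

end

section \<open>The Ising model\<close>

text \<open>The derivative is at most 1/4 in absolute value, because
  \<open>4 * exp z \<le> (1 + exp z)\<^sup>2\<close>.\<close>

lemma logistic_lipschitz:
  fixes x y :: real
  shows "\<bar>1 / (1 + exp x) - 1 / (1 + exp y)\<bar> \<le> \<bar>x - y\<bar> / 4"
proof -
  have *: "\<bar>1 / (1 + exp x) - 1 / (1 + exp y)\<bar> \<le> \<bar>x - y\<bar> / 4" if "x < y" for x y :: real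
  proof -
    have "\<exists>z. x < z \<and> z < y \<and> 1 / (1 + exp y) - 1 / (1 + exp x)
        = (y - x) * (- exp z / (1 + exp z)\<^sup>2)"
    proof (rule MVT2[OF that])
      fix z :: real
      have "1 + exp z \<noteq> 0" using exp_gt_zero[of z] by linarith
      then show "((\<lambda>x. 1 / (1 + exp x)) has_real_derivative - exp z / (1 + exp z)\<^sup>2) (at z)"
        by (auto intro!: derivative_eq_intros simp: power2_eq_square)
    qed
    then obtain z where z: "1 / (1 + exp y) - 1 / (1 + exp x) = (y - x) * (- exp z / (1 + exp z)\<^sup>2)"
      by blast
    have "0 \<le> (1 - exp z)\<^sup>2" by simp
    then have "4 * exp z \<le> (1 + exp z)\<^sup>2" by (simp add: power2_eq_square algebra_simps)
    then have "exp z / (1 + exp z)\<^sup>2 \<le> 1 / 4"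
      using exp_gt_zero[of z] by (simp add: divide_le_eq)
    moreover define Q where "Q = (y - x) * (exp z / (1 + exp z)\<^sup>2)"
    ultimately have "Q \<le> (y - x) * (1 / 4)"
      unfolding Q_def using that by (intro mult_left_mono) auto
    moreover have "0 \<le> Q" using that by (simp add: Q_def)
    moreover have "1 / (1 + exp y) - 1 / (1 + exp x) = - Q" using z by (simp add: Q_def)
    ultimately show ?thesis using that by (simp add: abs_if)
  qed
  consider "x < y" | "x = y" | "y < x" by linarith
  then show ?thesis
  proof cases
    case 3
    then show ?thesis using *[OF 3] by (simp add: abs_minus_commute)
  qed (use * in auto)
qed

text \<open>The total field acting on spin \<open>k\<close>. It does not depend on
  \<open>\<sigma> k\<close> when the diagonal of \<open>J\<close> vanishes.\<close>

definition local_field :: "nat \<Rightarrow> (nat \<Rightarrow> nat \<Rightarrow> real) \<Rightarrow> (nat \<Rightarrow> real) \<Rightarrow> nat \<Rightarrow> (nat \<Rightarrow> real) \<Rightarrow> real" where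
  "local_field n J h k \<sigma> = (\<Sum>j<n. J k j * \<sigma> j) + h k"

lemma gibbs_weight_pos: "0 < gibbs_weight n J h \<sigma>"
  by (simp add: gibbs_weight_def)

text \<open>Spin \<open>k\<close> enters the quadratic form through a row and a column, which agree
  by symmetry and cancel the factor 1/2. The zero diagonal removes the term quadratic in the
  increment.\<close>

lemma gibbs_weight_flip:
  assumes sym: "\<And>i j. i < n \<Longrightarrow> j < n \<Longrightarrow> J i j = J j i" and diag: "J k k = 0" and k: "k < n"
  shows "gibbs_weight n J h (flip k \<sigma>)
    = gibbs_weight n J h \<sigma> * exp (- 2 * \<sigma> k * local_field n J h k \<sigma>)"
proof -
  \<comment> \<open>The increment of the configuration under the flip.\<close>
  define a where "a i = (if i = k then - 2 * \<sigma> k else 0)" for i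
  have fl: "flip k \<sigma> i = \<sigma> i + a i" for i by (simp add: flip_def a_def)
  have a: "(\<Sum>i<n. F i * a i) = F k * (- 2 * \<sigma> k)" for F :: "nat \<Rightarrow> real"
    using k by (simp add: a_def if_distrib[of "\<lambda>x. _ * x"] cong: if_cong)
  have "(\<Sum>i<n. \<Sum>j<n. J i j * flip k \<sigma> i * flip k \<sigma> j)
    = (\<Sum>i<n. \<Sum>j<n. J i j * \<sigma> i * \<sigma> j) + (\<Sum>i<n. \<Sum>j<n. J i j * \<sigma> i * a j)
      + ((\<Sum>i<n. (\<Sum>j<n. J i j * \<sigma> j) * a i) + (\<Sum>i<n. (\<Sum>j<n. J i j * a j) * a i))"
    unfolding fl sum_distrib_right sum.distrib[symmetric]
    by (intro sum.cong refl) (simp add: algebra_simps)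
  also have "\<dots> = (\<Sum>i<n. \<Sum>j<n. J i j * \<sigma> i * \<sigma> j) + (\<Sum>i<n. J i k * \<sigma> i) * (- 2 * \<sigma> k)
      + (\<Sum>j<n. J k j * \<sigma> j) * (- 2 * \<sigma> k)"
    by (simp only: a diag) (simp add: sum_distrib_right sum_negf)
  also have "(\<Sum>i<n. J i k * \<sigma> i) = (\<Sum>j<n. J k j * \<sigma> j)"
    using sym k by (intro sum.cong) auto
  finally have quad: "(\<Sum>i<n. \<Sum>j<n. J i j * flip k \<sigma> i * flip k \<sigma> j)
    = (\<Sum>i<n. \<Sum>j<n. J i j * \<sigma> i * \<sigma> j) - 4 * \<sigma> k * (\<Sum>j<n. J k j * \<sigma> j)" by simp
  have lin: "(\<Sum>i<n. h i * flip k \<sigma> i) = (\<Sum>i<n. h i * \<sigma> i) - 2 * \<sigma> k * h k"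
    by (simp add: fl distrib_left sum.distrib a)
  have "exp (1 / 2 * (q - 4 * s * m) + (l - 2 * s * c)) = exp (1 / 2 * q + l) * exp (- 2 * s * (m + c))"
    for q s m l c :: real
    unfolding exp_add[symmetric] by (rule arg_cong[where f = exp]) (simp add: algebra_simps)
  then show ?thesis by (simp only: gibbs_weight_def quad lin local_field_def)
qed

text \<open>Conditional probabilities are logistic functions of the local field. A flip at
  \<open>i\<close> moves the argument at \<open>j\<close> by \<open>4 * \<bar>J i j\<bar>\<close>,
  and the Lipschitz constant 1/4 leaves \<open>\<bar>J i j\<bar>\<close>. The ratio bound holds
  because the local field is at most \<open>1 - \<alpha> + \<alpha>'\<close> in absolute
  value.\<close>

lemma ising_weak_dep:
  assumes \<alpha>: "0 < \<alpha>" "\<alpha> \<le> 1"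
    and sym: "\<And>i j. i < n \<Longrightarrow> j < n \<Longrightarrow> J i j = J j i" and diag: "\<And>i. i < n \<Longrightarrow> J i i = 0"
    and row: "\<And>i. i < n \<Longrightarrow> (\<Sum>j<n. \<bar>J i j\<bar>) \<le> 1 - \<alpha>" and h: "\<And>i. i < n \<Longrightarrow> \<bar>h i\<bar> \<le> \<alpha>'"
  shows "weak_dep {..<n} (\<lambda>i j. \<bar>J i j\<bar>) (exp (2 * (1 + \<alpha>'))) \<alpha> (gibbs_weight n J h)"
proof -
  have flip: "gibbs_weight n J h (flip k \<tau>)
      = gibbs_weight n J h \<tau> * exp (- 2 * \<tau> k * local_field n J h k \<tau>)" if "k < n" for k \<tau>
  proof (rule gibbs_weight_flip)
    show "J k k = 0" "k < n" using diag that by blast+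
    fix i j assume "i < n" "j < n"
    then show "J i j = J j i" by (rule sym)
  qed
  show ?thesis
  proof
    fix i \<sigma> assume i: "i \<in> {..<n}" and \<sigma>: "\<sigma> \<in> spins {..<n}"
    have one: "\<bar>\<sigma> j\<bar> = 1" if "j < n" for j
    proof -
      have "\<sigma> j = -1 \<or> \<sigma> j = 1" using \<sigma> that by (simp add: spins_def)
      then show ?thesis by auto
    qed
    have "\<bar>\<Sum>j<n. J i j * \<sigma> j\<bar> \<le> (\<Sum>j<n. \<bar>J i j\<bar>)"
      by (rule order_trans[OF sum_abs]) (simp add: abs_mult one)
    then have "\<bar>local_field n J h i \<sigma>\<bar> \<le> 1 + \<alpha>'"
      using row[of i] h[of i] \<alpha> i unfolding local_field_def by simp
    moreover have "\<bar>\<sigma> i * local_field n J h i \<sigma>\<bar> = \<bar>local_field n J h i \<sigma>\<bar>"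
      using one[of i] i by (simp add: abs_mult)
    ultimately have "\<bar>\<sigma> i * local_field n J h i \<sigma>\<bar> \<le> 1 + \<alpha>'" by simp
    from abs_le_D2[OF this] have "- 2 * (\<sigma> i * local_field n J h i \<sigma>) \<le> 2 * (1 + \<alpha>')" by simp
    then show "gibbs_weight n J h (flip i \<sigma>) \<le> exp (2 * (1 + \<alpha>')) * gibbs_weight n J h \<sigma>"
      using flip[of i \<sigma>] i gibbs_weight_pos[of n J h \<sigma>]
      by (simp add: mult.commute)
  next
    fix i j \<sigma> assume i: "i \<in> {..<n}" and j: "j \<in> {..<n}" and ij: "i \<noteq> j" and \<sigma>: "\<sigma> \<in> spins {..<n}"
    let ?w = "gibbs_weight n J h" and ?m = "local_field n J h j"
    have one: "\<bar>\<sigma> k\<bar> = 1" if "k < n" for k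
    proof -
      have "\<sigma> k = -1 \<or> \<sigma> k = 1" using \<sigma> that by (simp add: spins_def)
      then show ?thesis by auto
    qed
    have p: "?w \<tau> / (?w \<tau> + ?w (flip j \<tau>)) = 1 / (1 + exp (- 2 * \<tau> j * ?m \<tau>))" for \<tau>
    proof -
      have "?w \<tau> + ?w (flip j \<tau>) = ?w \<tau> * (1 + exp (- 2 * \<tau> j * ?m \<tau>))"
        using flip[of j \<tau>] j by (simp add: algebra_simps)
      then show ?thesis using gibbs_weight_pos[of n J h \<tau>] by simp
    qed
    have "?m (flip i \<sigma>) = (\<Sum>k<n. J j k * \<sigma> k + (if k = i then - 2 * J j i * \<sigma> i else 0)) + h j"
      unfolding local_field_def by (intro arg_cong2[where f = "(+)"] sum.cong) (auto simp: flip_def)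
    also have "\<dots> = ?m \<sigma> - 2 * J j i * \<sigma> i"
      using i by (simp add: sum.distrib local_field_def)
    finally have m: "?m (flip i \<sigma>) = ?m \<sigma> - 2 * J j i * \<sigma> i" .
    have "- 2 * \<sigma> j * ?m \<sigma> - - 2 * flip i \<sigma> j * ?m (flip i \<sigma>) = - 4 * (\<sigma> i * \<sigma> j * J j i)"
      using ij unfolding m by (simp add: flip_def algebra_simps)
    then have "\<bar>- 2 * \<sigma> j * ?m \<sigma> - - 2 * flip i \<sigma> j * ?m (flip i \<sigma>)\<bar> / 4 = \<bar>J i j\<bar>"
      using one i j sym[of i j] by (simp add: abs_mult)
    then show "\<bar>?w \<sigma> / (?w \<sigma> + ?w (flip j \<sigma>))
         - ?w (flip i \<sigma>) / (?w (flip i \<sigma>) + ?w (flip j (flip i \<sigma>)))\<bar> \<le> \<bar>J i j\<bar>"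
      unfolding p using logistic_lipschitz by metis
  next
    fix i j assume "i \<in> {..<n}" "j \<in> {..<n}"
    then show "\<bar>J i j\<bar> = \<bar>J j i\<bar>" using sym[of i j] by simp
  next
    fix i assume "i \<in> {..<n}"
    then show "(\<Sum>j<n. \<bar>J i j\<bar>) \<le> 1 - \<alpha>" using row by simp
  qed (simp_all add: \<alpha> gibbs_weight_pos)
qed

lemma qprob_nonneg: "0 \<le> qprob n J h \<sigma>"
  by (auto simp: qprob_def less_imp_le gibbs_weight_pos intro!: divide_nonneg_nonneg sum_nonneg)

text \<open>Markov's inequality for the exponential moment.\<close>

lemma markov_exp:
  fixes X :: "(nat \<Rightarrow> real) \<Rightarrow> real"
  assumes C: "0 < C" and t: "0 < t" and r: "0 < r"
  shows "qmeasure n J h (\<lambda>\<sigma>. X \<sigma> \<ge> t) \<le> qexp n J h (\<lambda>\<sigma>. exp (C * X \<sigma> powr r)) * exp (- C * t powr r)"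
proof -
  have fin: "finite (cube n)" by (simp add: cube_eq_spins finite_spins)
  have "qmeasure n J h (\<lambda>\<sigma>. X \<sigma> \<ge> t)
      \<le> (\<Sum>\<sigma>\<in>{\<sigma> \<in> cube n. X \<sigma> \<ge> t}. qprob n J h \<sigma> * exp (C * X \<sigma> powr r) * exp (- C * t powr r))"
    unfolding qmeasure_def
  proof (rule sum_mono)
    fix \<sigma> assume "\<sigma> \<in> {\<sigma> \<in> cube n. X \<sigma> \<ge> t}"
    then have "t powr r \<le> X \<sigma> powr r" using t r by (intro powr_mono2) auto
    then have "1 \<le> exp (C * X \<sigma> powr r) * exp (- C * t powr r)"
      using C by (simp flip: exp_add)
    then have "qprob n J h \<sigma> * 1 \<le> qprob n J h \<sigma> * (exp (C * X \<sigma> powr r) * exp (- C * t powr r))"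
      by (intro mult_left_mono qprob_nonneg)
    then show "qprob n J h \<sigma> \<le> qprob n J h \<sigma> * exp (C * X \<sigma> powr r) * exp (- C * t powr r)"
      by (simp add: mult.assoc)
  qed
  also have "\<dots> \<le> (\<Sum>\<sigma>\<in>cube n. qprob n J h \<sigma> * exp (C * X \<sigma> powr r) * exp (- C * t powr r))"
    using fin by (intro sum_mono2) (auto intro!: mult_nonneg_nonneg qprob_nonneg)
  finally show ?thesis by (simp add: qexp_def sum_distrib_right)
qed

theorem theorem1p2:
  fixes \<alpha> \<alpha>' :: real and d :: nat
  assumes "0 < \<alpha>" and "\<alpha> \<le> 1" and "0 \<le> \<alpha>'" and "1 \<le> d"
  shows "\<exists>C>0. \<forall>(n::nat) (J::nat \<Rightarrow> nat \<Rightarrow> real) (h::nat \<Rightarrow> real) (f::(nat \<Rightarrow> real) \<Rightarrow> real).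
           (\<forall>i<n. \<forall>j<n. J i j = J j i) \<longrightarrow>
           (\<forall>i<n. J i i = 0) \<longrightarrow>
           (\<forall>i<n. (\<Sum>j<n. \<bar>J i j\<bar>) \<le> 1 - \<alpha>) \<longrightarrow>
           (\<forall>i<n. \<bar>h i\<bar> \<le> \<alpha>') \<longrightarrow>
           (\<forall>k\<in>{1..<d}. hnorm2 n J h k f \<le> 1) \<longrightarrow>
           hnorm_inf n J h d f \<le> 1 \<longrightarrow>
           qexp n J h (\<lambda>\<sigma>. exp (C * \<bar>f \<sigma> - qexp n J h f\<bar> powr (2 / real d))) \<le> 2 \<and>
           (\<forall>t>0. qmeasure n J h (\<lambda>\<sigma>. \<bar>f \<sigma> - qexp n J h f\<bar> \<ge> t)
                    \<le> 2 * exp (- C * t powr (2 / real d)))"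
proof -
  \<comment> \<open>\<open>R\<close> is the ratio bound of the Ising weights, \<open>L\<close> comes
    from \<open>fractional_moment\<close> with \<open>D = real d + 1\<close>, and \<open>C\<close>
    is the rate in \<open>exp_moment\<close>. All are fixed before \<open>n\<close>,
    \<open>J\<close>, \<open>h\<close> and \<open>f\<close>.\<close>
  define R where "R = exp (2 * (1 + \<alpha>'))"
  define L where "L = 4 * moment_const R \<alpha> * (real d + 1)\<^sup>2"
  define C where "C = 1 / (3 * exp 1 * L)"
  have R: "0 \<le> R" by (simp add: R_def)
  have "0 < moment_const R \<alpha>" using assms(1) R by (simp add: moment_const_def lsi_const_def add_pos_nonneg)
  then have L: "0 < L" by (simp add: L_def)
  have "qexp n J h (\<lambda>\<sigma>. exp (C * \<bar>f \<sigma> - qexp n J h f\<bar> powr (2 / real d))) \<le> 2"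
    if J: "\<forall>i<n. \<forall>j<n. J i j = J j i" "\<forall>i<n. J i i = 0" "\<forall>i<n. (\<Sum>j<n. \<bar>J i j\<bar>) \<le> 1 - \<alpha>"
      and h: "\<forall>i<n. \<bar>h i\<bar> \<le> \<alpha>'"
      and norm2: "\<forall>k\<in>{1..<d}. hnorm2 n J h k f \<le> 1"
      and norm_inf: "hnorm_inf n J h d f \<le> 1"
    for n J h f
  proof -
    interpret weak_dep "{..<n}" "\<lambda>i j. \<bar>J i j\<bar>" R \<alpha> "gibbs_weight n J h"
      unfolding R_def by (rule ising_weak_dep) (use assms J h in auto)
    have q: "qexp n J h g = mean g" for g
      by (simp add: qexp_def mean_def qprob_def Z_def cube_eq_spins sum_divide_distrib)
    have n2: "mean (\<lambda>\<sigma>. (htensor_norm n k f \<sigma>)\<^sup>2) \<le> 1" if "k \<in> {1..<d}" for k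
      using norm2 that by (auto simp: hnorm2_def q)
    have sup: "htensor_norm n d f \<sigma> \<le> 1" if "\<sigma> \<in> spins {..<n}" for \<sigma>
    proof -
      \<comment> \<open>The Gibbs measure charges every configuration, so the maximum over the
        support bounds the tensor norm on the whole cube.\<close>
      have "0 < qprob n J h \<sigma>"
        using gibbs_weight_pos Z_pos by (simp add: qprob_def Z_def cube_eq_spins)
      then have "htensor_norm n d f \<sigma> \<le> hnorm_inf n J h d f"
        unfolding hnorm_inf_def using that
        by (intro Max_ge) (auto simp: cube_eq_spins finite_spins)
      then show ?thesis using norm_inf by simp
    qed
    have "mean (\<lambda>\<sigma>. (\<bar>f \<sigma> - mean f\<bar> powr (2 / real d)) ^ m) \<le> 2 * (L * real m) ^ m"
      if "1 \<le> m" for m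
      unfolding L_def
    proof (rule fractional_moment)
      show "mean (\<lambda>\<sigma>. \<bar>f \<sigma> - mean f\<bar> ^ (2 ^ k)) \<le> ((real d + 1) * sqrt (K * 2 ^ k) ^ d) ^ (2 ^ k)" for k
        by (rule centered_moment[OF refl R assms(4)]) (use n2 sup in auto)
    qed (use assms(4) that moment_const_ge[OF R] in auto)
    then show ?thesis unfolding q C_def by (rule exp_moment[OF L])
  qed
  moreover have "qmeasure n J h (\<lambda>\<sigma>. \<bar>f \<sigma> - qexp n J h f\<bar> \<ge> t) \<le> 2 * exp (- C * t powr (2 / real d))"
    if "qexp n J h (\<lambda>\<sigma>. exp (C * \<bar>f \<sigma> - qexp n J h f\<bar> powr (2 / real d))) \<le> 2" "0 < t" for n J h f t
  proof -
    have "qmeasure n J h (\<lambda>\<sigma>. \<bar>f \<sigma> - qexp n J h f\<bar> \<ge> t)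
        \<le> qexp n J h (\<lambda>\<sigma>. exp (C * \<bar>f \<sigma> - qexp n J h f\<bar> powr (2 / real d))) * exp (- C * t powr (2 / real d))"
      using L assms(4) that(2) by (intro markov_exp) (auto simp: C_def)
    also have "\<dots> \<le> 2 * exp (- C * t powr (2 / real d))"
      using that(1) by (rule mult_right_mono) simp
    finally show ?thesis .
  qed
  ultimately show ?thesis using L by (intro exI[of _ C]) (auto simp: C_def)
qed

end
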